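(* Let $p\ge 1$ be an integer. Let $A\subset\mathbb{R}^m$ and let $f,g:A\to\mathbb{R}$ be two definable functions such that $|g|$ is bounded. Assume that for every sequence $\{x_n\}_{n=0}^{\infty}\subset A$, if $f(x_n)\to 0$ then $g(x_n)\to 0$. Then there exists a definable $\varphi\in\Phi_p$ such that $|f(x)|\ge|\varphi(g(x))|$ for all $x\in A$.
   Context: Definable means definable in a fixed o-minimal structure on the real field $(\mathbb{R},+,\cdot)$ (a structure containing all real algebraic sets, whose definable subsets of $\mathbb{R}$ are exactly the finite unions of points and intervals). A function is definable if its graph is a definable set (hence its domain is definable). $\Phi_p$ is the set of all odd, increasing bijections $\phi:\mathbb{R}\to\mathbb{R}$ of class $\mathcal{C}^p$ with $\phi^{(k)}(0)=0$ for $k\in\{1,\dots,p\}$. *)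

theory Defs
  imports "HOL-Analysis.Analysis"
begin

text \<open>
  The dimension \<open>n\<close> varies inside the notion of a structure, so a point of \<open>\<real>\<^sup>n\<close> is a list of
  reals of length \<open>n\<close>, and \<open>\<real>\<^sup>m \<times> \<real>\<^sup>n\<close> is identified with \<open>\<real>\<^sup>m\<^sup>+\<^sup>n\<close> by appending lists.
\<close>

definition Rn :: "nat \<Rightarrow> real list set" where
  "Rn n = {x. length x = n}"

inductive real_poly :: "nat \<Rightarrow> (real list \<Rightarrow> real) \<Rightarrow> bool" for n :: nat where
  const: "real_poly n (\<lambda>x. c)"
| coord: "i < n \<Longrightarrow> real_poly n (\<lambda>x. x ! i)"
| add: "real_poly n q \<Longrightarrow> real_poly n r \<Longrightarrow> real_poly n (\<lambda>x. q x + r x)"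
| mult: "real_poly n q \<Longrightarrow> real_poly n r \<Longrightarrow> real_poly n (\<lambda>x. q x * r x)"

definition algebraic_set :: "nat \<Rightarrow> real list set \<Rightarrow> bool" where
  "algebraic_set n X \<longleftrightarrow>
     (\<exists>Q. finite Q \<and> (\<forall>q\<in>Q. real_poly n q) \<and> X = {x \<in> Rn n. \<forall>q\<in>Q. q x = 0})"

definition finite_union_of_points_and_intervals :: "real set \<Rightarrow> bool" where
  "finite_union_of_points_and_intervals X \<longleftrightarrow>
     (\<exists>F. finite F \<and> (\<forall>I\<in>F. (\<exists>a. I = {a}) \<or> is_interval I) \<and> X = \<Union>F)"

text \<open>
  \<open>S n\<close> is the collection of definable subsets of \<open>\<real>\<^sup>n\<close>. The index \<open>n = 0\<close> is harmless: the
  assumptions force \<open>S 0\<close> to consist of both subsets of the one-point space \<open>\<real>\<^sup>0\<close>.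
\<close>

locale ominimal_structure =
  fixes S :: "nat \<Rightarrow> real list set set"
  assumes boolean_algebra: "algebra (Rn n) (S n)"
    and product: "X \<in> S m \<Longrightarrow> Y \<in> S n \<Longrightarrow> {x @ y | x y. x \<in> X \<and> y \<in> Y} \<in> S (m + n)"
    and projection: "X \<in> S (Suc n) \<Longrightarrow> butlast ` X \<in> S n"
    and algebraic: "algebraic_set n X \<Longrightarrow> X \<in> S n"
    and o_minimal: "(\<lambda>t. [t]) ` T \<in> S 1 \<longleftrightarrow> finite_union_of_points_and_intervals T"

text \<open>
  Functions are total in HOL, so the domain \<open>A\<close> is explicit and only the values on \<open>A\<close> matter.
\<close>

definition definable_fun ::
  "(nat \<Rightarrow> real list set set) \<Rightarrow> nat \<Rightarrow> real list set \<Rightarrow> (real list \<Rightarrow> real) \<Rightarrow> bool" where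
  "definable_fun S m A f \<longleftrightarrow> A \<subseteq> Rn m \<and> {x @ [f x] | x. x \<in> A} \<in> S (m + 1)"

definition definable_real_fun :: "(nat \<Rightarrow> real list set set) \<Rightarrow> (real \<Rightarrow> real) \<Rightarrow> bool" where
  "definable_real_fun S \<phi> \<longleftrightarrow> definable_fun S 1 (Rn 1) (\<lambda>x. \<phi> (x ! 0))"

definition C_class :: "nat \<Rightarrow> (real \<Rightarrow> real) \<Rightarrow> bool" where
  "C_class p \<phi> \<longleftrightarrow>
     (\<forall>k<p. \<forall>x. (deriv ^^ k) \<phi> differentiable (at x)) \<and> continuous_on UNIV ((deriv ^^ p) \<phi>)"

definition Phi :: "nat \<Rightarrow> (real \<Rightarrow> real) set" where
  "Phi p = {\<phi>. (\<forall>x. \<phi> (- x) = - \<phi> x) \<and> strict_mono \<phi> \<and> bij \<phi> \<and> C_class p \<phi> \<and>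
                (\<forall>k\<in>{1..p}. (deriv ^^ k) \<phi> 0 = 0)}"

end

theory Submission
  imports Defs
begin

text \<open>
  Put \<open>h(t) = inf ({1} \<union> {|f(x)| : |g(x)| \<ge> t})\<close>. This is a definable nondecreasing function with
  \<open>h(|g(x)|) \<le> |f(x)|\<close>, and the hypothesis on sequences says that \<open>h > 0\<close> on \<open>(0, \<infinity>)\<close>. By o-minimality
  \<open>h\<close> is \<open>C\<^sup>p\<close> on some \<open>(0, \<epsilon>)\<close>, hence so is \<open>u(t) = h(\<epsilon>t\<^sup>2/(1 + t\<^sup>2))\<close> on all of \<open>\<real> - {0}\<close>, and
  \<open>u(t) \<le> h(|t|)\<close> if \<open>\<epsilon> \<le> 1\<close>. The function sought is \<open>\<phi>(t) = c t\<^sup>N u(t)\<close> with \<open>N = 2p + 1\<close> and \<open>c\<close> small.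
  It is \<open>p\<close>-flat at the origin because a definable function that is bounded near \<open>0\<close> has a monotone
  derivative there, so that \<open>t u'(t)\<close> is again bounded, and definable.

  The one-variable regularity results are obtained without the cell decomposition machinery: an
  uncountable definable subset of the line contains an interval, so a countable cover of an interval
  by definable sets has a member with nonempty interior.
\<close>

section \<open>Closure properties of definable sets\<close>

text \<open>The projection axiom removes one last coordinate at a time; induction on
  \<open>k\<close> yields the projection onto any initial block of coordinates.\<close>

lemma take_image_mem:
  assumes "ominimal_structure S" "X \<in> S (n + k)"
  shows "take n ` X \<in> S n"
  using assms(2)
proof (induction k arbitrary: X)
  case 0
  interpret algebra "Rn n" "S n" using ominimal_structure.boolean_algebra[OF assms(1)] .
  have "X \<subseteq> Rn n" using 0 space_closed by auto
  then have "take n ` X = X" by (force simp: Rn_def image_iff)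
  then show ?case using 0 by simp
next
  case (Suc k)
  interpret algebra "Rn (n + Suc k)" "S (n + Suc k)" using ominimal_structure.boolean_algebra[OF assms(1)] .
  have X: "X \<subseteq> Rn (n + Suc k)" using Suc space_closed by auto
  have "butlast ` X \<in> S (n + k)"
    using ominimal_structure.projection[OF assms(1)] Suc.prems by simp
  from Suc.IH[OF this] have "take n ` butlast ` X \<in> S n" .
  moreover have "take n ` butlast ` X = take n ` X"
    unfolding image_image
    by (rule image_cong) (use X in \<open>auto simp: Rn_def take_butlast\<close>)
  ultimately show ?case by simp
qed

section \<open>Formulas and terms: Boolean operations, quantifiers and substitution\<close>

context ominimal_structure
begin

text \<open>A formula in \<open>n\<close> free variables is encoded as a predicate on lists.
  Connectives become Boolean operations and quantifiers become projections, so definability of a set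
  can be read off from a formula describing it. Lists of other lengths are ignored.\<close>

definition definable_pred :: "nat \<Rightarrow> (real list \<Rightarrow> bool) \<Rightarrow> bool" where
  "definable_pred n P \<longleftrightarrow> {x \<in> Rn n. P x} \<in> S n"

text \<open>Terms are total on \<open>Rn n\<close>; a function given on a smaller domain is first
  extended by a default value. Coordinate \<open>n\<close>, the last one, carries the value.\<close>

definition definable_term :: "nat \<Rightarrow> (real list \<Rightarrow> real) \<Rightarrow> bool" where
  "definable_term n F \<longleftrightarrow> definable_pred (Suc n) (\<lambda>x. x ! n = F (take n x))"

lemma definable_pred_cong:
  assumes "\<And>x. length x = n \<Longrightarrow> P x = Q x"
  shows "definable_pred n P \<longleftrightarrow> definable_pred n Q"
proof -
  have "{x \<in> Rn n. P x} = {x \<in> Rn n. Q x}" using assms by (auto simp: Rn_def)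
  then show ?thesis by (simp add: definable_pred_def)
qed

lemma definable_pred_conj:
  assumes "definable_pred n P" "definable_pred n Q"
  shows "definable_pred n (\<lambda>x. P x \<and> Q x)"
proof -
  interpret algebra "Rn n" "S n" using boolean_algebra .
  have "{x \<in> Rn n. P x \<and> Q x} = {x \<in> Rn n. P x} \<inter> {x \<in> Rn n. Q x}" by auto
  then show ?thesis using assms Int unfolding definable_pred_def by simp
qed

lemma definable_pred_not:
  assumes "definable_pred n P"
  shows "definable_pred n (\<lambda>x. \<not> P x)"
proof -
  interpret algebra "Rn n" "S n" using boolean_algebra .
  have "{x \<in> Rn n. \<not> P x} = Rn n - {x \<in> Rn n. P x}" by auto
  then show ?thesis using assms compl_sets unfolding definable_pred_def by simp
qed

lemma definable_pred_disj:
  assumes "definable_pred n P" "definable_pred n Q"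
  shows "definable_pred n (\<lambda>x. P x \<or> Q x)"
  using definable_pred_not[OF definable_pred_conj[OF assms[THEN definable_pred_not]]] by simp

lemma definable_pred_imp:
  assumes "definable_pred n P" "definable_pred n Q"
  shows "definable_pred n (\<lambda>x. P x \<longrightarrow> Q x)"
  using definable_pred_disj[OF definable_pred_not[OF assms(1)] assms(2)] by simp

lemma definable_pred_const: "definable_pred n (\<lambda>x. b)"
proof -
  interpret algebra "Rn n" "S n" using boolean_algebra .
  show ?thesis unfolding definable_pred_def by (cases b) (simp_all add: top)
qed

lemma definable_pred_Ball:
  assumes "finite J" "\<And>j. j \<in> J \<Longrightarrow> definable_pred n (P j)"
  shows "definable_pred n (\<lambda>x. \<forall>j\<in>J. P j x)"
  using assms
  by (induction J rule: finite_induct) (simp_all add: definable_pred_const definable_pred_conj)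

text \<open>The witness occupies the last \<open>k\<close> coordinates, so quantifying over it is
  the projection \<open>take n\<close>.\<close>

lemma definable_pred_ex_list:
  assumes "definable_pred (n + k) (\<lambda>z. P (take n z) (drop n z))"
  shows "definable_pred n (\<lambda>x. \<exists>y. length y = k \<and> P x y)"
proof -
  have "take n ` {z \<in> Rn (n + k). P (take n z) (drop n z)} = {x \<in> Rn n. \<exists>y. length y = k \<and> P x y}"
  proof (intro equalityI subsetI)
    fix x assume "x \<in> {x \<in> Rn n. \<exists>y. length y = k \<and> P x y}"
    then obtain y where "length x = n" "length y = k" "P x y" by (auto simp: Rn_def)
    then show "x \<in> take n ` {z \<in> Rn (n + k). P (take n z) (drop n z)}"
      by (intro image_eqI[of _ _ "x @ y"]) (auto simp: Rn_def)
  qed (auto simp: Rn_def intro!: exI[of _ "drop n _"])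
  moreover have "ominimal_structure S" ..
  ultimately show ?thesis
    using take_image_mem[of S _ n k] assms unfolding definable_pred_def by metis
qed

lemma definable_pred_ex:
  assumes "definable_pred (Suc n) (\<lambda>z. P (take n z) (z ! n))"
  shows "definable_pred n (\<lambda>x. \<exists>t. P x t)"
proof -
  have "definable_pred (n + 1) (\<lambda>z. P (take n z) (drop n z ! 0))"
    using assms by (subst definable_pred_cong[of _ _ "\<lambda>z. P (take n z) (z ! n)"]) simp_all
  then have "definable_pred n (\<lambda>x. \<exists>y. length y = 1 \<and> P x (y ! 0))"
    by (rule definable_pred_ex_list)
  moreover have "(\<exists>y. length y = 1 \<and> P x (y ! 0)) \<longleftrightarrow> (\<exists>t. P x t)" for x
  proof
    assume "\<exists>t. P x t"
    then obtain t where "P x t" ..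
    then show "\<exists>y. length y = 1 \<and> P x (y ! 0)" by (intro exI[of _ "[t]"]) simp
  qed auto
  ultimately show ?thesis by simp
qed

lemma definable_pred_all:
  assumes "definable_pred (Suc n) (\<lambda>z. P (take n z) (z ! n))"
  shows "definable_pred n (\<lambda>x. \<forall>t. P x t)"
  using definable_pred_not[OF definable_pred_ex[OF definable_pred_not[OF assms]]] by simp

lemma definable_pred_polys:
  assumes "finite Q" "\<And>q. q \<in> Q \<Longrightarrow> real_poly n q"
  shows "definable_pred n (\<lambda>x. \<forall>q\<in>Q. q x = 0)"
  unfolding definable_pred_def
  by (rule algebraic) (use assms in \<open>auto simp: algebraic_set_def\<close>)

lemma definable_pred_poly: "real_poly n q \<Longrightarrow> definable_pred n (\<lambda>x. q x = 0)"
  using definable_pred_polys[of "{q}" n] by simp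

lemma real_poly_diff:
  assumes "real_poly n q" "real_poly n r"
  shows "real_poly n (\<lambda>x. q x - r x)"
  using real_poly.add[OF assms(1) real_poly.mult[OF real_poly.const[of n "- 1"] assms(2)]] by simp

text \<open>A cylinder: the product axiom with the whole space \<open>Rn n\<close> as first
  factor.\<close>

lemma definable_pred_prod:
  assumes "definable_pred k P"
  shows "definable_pred (n + k) (\<lambda>z. P (drop n z))"
proof -
  interpret algebra "Rn n" "S n" using boolean_algebra .
  have "{x @ y | x y. x \<in> Rn n \<and> y \<in> {y \<in> Rn k. P y}} \<in> S (n + k)"
    using assms by (intro product top) (simp add: definable_pred_def)
  moreover have "{x @ y | x y. x \<in> Rn n \<and> y \<in> {y \<in> Rn k. P y}} = {z \<in> Rn (n + k). P (drop n z)}"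
  proof (intro equalityI subsetI)
    fix z assume "z \<in> {z \<in> Rn (n + k). P (drop n z)}"
    then show "z \<in> {x @ y | x y. x \<in> Rn n \<and> y \<in> {y \<in> Rn k. P y}}"
      by (intro CollectI exI[of _ "take n z"] exI[of _ "drop n z"]) (auto simp: Rn_def)
  qed (auto simp: Rn_def)
  ultimately show ?thesis by (simp add: definable_pred_def)
qed

text \<open>Adjoin variables for the values \<open>F j\<close>, then project them away.\<close>

lemma definable_pred_subst_aux:
  assumes P: "definable_pred k P"
    and F: "\<And>j. j < k \<Longrightarrow> definable_pred (n + k) (\<lambda>z. z ! (n + j) = F j (take n z))"
  shows "definable_pred n (\<lambda>x. P (map (\<lambda>j. F j x) [0..<k]))"
proof -
  have "definable_pred (n + k) (\<lambda>z. P (drop n z) \<and> (\<forall>j\<in>{..<k}. z ! (n + j) = F j (take n z)))"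
    by (intro definable_pred_conj definable_pred_prod P definable_pred_Ball F) auto
  then have "definable_pred (n + k) (\<lambda>z. P (drop n z) \<and> (\<forall>j\<in>{..<k}. drop n z ! j = F j (take n z)))"
    by (subst definable_pred_cong[of _ _ "\<lambda>z. P (drop n z) \<and> (\<forall>j\<in>{..<k}. z ! (n + j) = F j (take n z))"]) auto
  then have "definable_pred n (\<lambda>x. \<exists>y. length y = k \<and> P y \<and> (\<forall>j\<in>{..<k}. y ! j = F j x))"
    by (rule definable_pred_ex_list)
  moreover have "(\<exists>y. length y = k \<and> P y \<and> (\<forall>j\<in>{..<k}. y ! j = F j x)) \<longleftrightarrow>
      P (map (\<lambda>j. F j x) [0..<k])" for x
  proof
    assume "\<exists>y. length y = k \<and> P y \<and> (\<forall>j\<in>{..<k}. y ! j = F j x)"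
    then obtain y where y: "length y = k" "P y" "\<And>j. j < k \<Longrightarrow> y ! j = F j x" by auto
    then have "y = map (\<lambda>j. F j x) [0..<k]" by (intro nth_equalityI) auto
    with y show "P (map (\<lambda>j. F j x) [0..<k])" by simp
  qed (auto intro!: exI[of _ "map (\<lambda>j. F j x) [0..<k]"])
  ultimately show ?thesis by simp
qed

text \<open>Permuting, repeating and adding dummy variables. The graph of a coordinate is a linear
  equation, so the algebraic sets suffice here; general substitution then relies on this case to
  move graphs between spaces.\<close>

lemma definable_pred_reindex:
  assumes "definable_pred k P" "\<And>j. j < k \<Longrightarrow> i j < n"
  shows "definable_pred n (\<lambda>x. P (map (\<lambda>j. x ! i j) [0..<k]))"
proof (rule definable_pred_subst_aux[OF assms(1)])
  fix j assume j: "j < k"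
  have "definable_pred (n + k) (\<lambda>z. z ! (n + j) - z ! i j = 0)"
    using j assms(2)[OF j] by (intro definable_pred_poly real_poly_diff real_poly.coord) auto
  then show "definable_pred (n + k) (\<lambda>z. z ! (n + j) = take n z ! i j)"
    using assms(2)[OF j] by simp
qed

lemma definable_pred_subst:
  assumes P: "definable_pred k P" and F: "\<And>j. j < k \<Longrightarrow> definable_term n (F j)"
  shows "definable_pred n (\<lambda>x. P (map (\<lambda>j. F j x) [0..<k]))"
proof (rule definable_pred_subst_aux[OF P])
  fix j assume j: "j < k"
  \<comment> \<open>\<open>?i\<close> keeps the \<open>n\<close> parameters and picks the
    \<open>j\<close>-th auxiliary variable as the value coordinate of the graph of
    \<open>F j\<close>.\<close>
  let ?i = "\<lambda>l. if l < n then l else n + j"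
  have "definable_pred (n + k) (\<lambda>z. (\<lambda>y. y ! n = F j (take n y)) (map (\<lambda>l. z ! ?i l) [0..<Suc n]))"
    by (rule definable_pred_reindex) (use F[OF j] j in \<open>auto simp: definable_term_def\<close>)
  moreover have "take n (map (\<lambda>l. z ! ?i l) [0..<Suc n]) = take n z" if "length z = n + k" for z :: "real list"
    using that by (intro nth_equalityI) auto
  moreover have "map (\<lambda>l. z ! ?i l) [0..<Suc n] ! n = z ! (n + j)" for z :: "real list"
    by (subst nth_map) (auto simp del: upt_Suc)
  ultimately show "definable_pred (n + k) (\<lambda>z. z ! (n + j) = F j (take n z))"
    by (subst (asm) definable_pred_cong[of _ _ "\<lambda>z. z ! (n + j) = F j (take n z)"]) (auto simp del: upt_Suc)
qed

lemma definable_term_subst: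
  assumes G: "definable_term k G" and F: "\<And>j. j < k \<Longrightarrow> definable_term n (F j)"
  shows "definable_term n (\<lambda>x. G (map (\<lambda>j. F j x) [0..<k]))"
proof -
  \<comment> \<open>The graph of \<open>G\<close> is a predicate in \<open>k + 1\<close> variables:
    its last slot receives the output \<open>z ! n\<close> of the composite.\<close>
  let ?F = "\<lambda>j z. if j < k then F j (take n z) else z ! n"
  have "definable_term (Suc n) (?F j)" if j: "j < Suc k" for j
  proof (cases "j < k")
    case True
    \<comment> \<open>Coordinate \<open>n\<close> is taken by the output of the composite, so the
      value of \<open>F j\<close> sits at \<open>Suc n\<close>.\<close>
    let ?i = "\<lambda>l. if l < n then l else Suc n"
    have "definable_pred (Suc (Suc n)) (\<lambda>z. (\<lambda>y. y ! n = F j (take n y)) (map (\<lambda>l. z ! ?i l) [0..<Suc n]))"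
      by (rule definable_pred_reindex) (use F[OF True] in \<open>auto simp: definable_term_def\<close>)
    moreover have "take n (map (\<lambda>l. z ! ?i l) [0..<Suc n]) = take n z" if "length z = Suc (Suc n)" for z :: "real list"
      using that by (intro nth_equalityI) auto
    moreover have "map (\<lambda>l. z ! ?i l) [0..<Suc n] ! n = z ! Suc n" for z :: "real list"
      by (subst nth_map) (auto simp del: upt_Suc)
    ultimately show ?thesis
      unfolding definable_term_def using True
      by (subst (asm) definable_pred_cong[of _ _ "\<lambda>z. z ! Suc n = F j (take n z)"]) (auto simp: min_def simp del: upt_Suc)
  next
    case False
    have "definable_pred (Suc (Suc n)) (\<lambda>z. z ! Suc n - z ! n = 0)"
      by (intro definable_pred_poly real_poly_diff real_poly.coord) auto
    then show ?thesis using False by (simp add: definable_term_def)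
  qed
  from definable_pred_subst[OF G[unfolded definable_term_def], of "Suc n" ?F, OF this]
  have "definable_pred (Suc n) (\<lambda>x. map (\<lambda>j. ?F j x) [0..<Suc k] ! k = G (take k (map (\<lambda>j. ?F j x) [0..<Suc k])))" .
  moreover have "map (\<lambda>j. ?F j x) [0..<Suc k] ! k = x ! n" for x
    by (subst nth_map) (auto simp del: upt_Suc)
  moreover have "take k (map (\<lambda>j. ?F j x) [0..<Suc k]) = map (\<lambda>j. F j (take n x)) [0..<k]" for x
    by (intro nth_equalityI) (auto simp: nth_append)
  ultimately show ?thesis unfolding definable_term_def by (simp del: upt_Suc)
qed

section \<open>Arithmetic operations, order and case distinctions\<close>

lemma definable_term_poly:
  assumes "real_poly (Suc n) (\<lambda>x. F (take n x))"
  shows "definable_term n F"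
  using definable_pred_poly[OF real_poly_diff[OF real_poly.coord[of n "Suc n"] assms]]
  by (simp add: definable_term_def)

lemma definable_term_const: "definable_term n (\<lambda>x. c)"
  by (intro definable_term_poly real_poly.const)

lemma definable_term_nth: "i < n \<Longrightarrow> definable_term n (\<lambda>x. x ! i)"
  by (rule definable_term_poly) (simp add: real_poly.coord)

lemma definable_term_cong:
  assumes "\<And>x. length x = n \<Longrightarrow> F x = G x"
  shows "definable_term n F \<longleftrightarrow> definable_term n G"
  unfolding definable_term_def by (rule definable_pred_cong) (simp add: assms)

lemma definable_term_drop:
  assumes "definable_term k F"
  shows "definable_term (n + k) (\<lambda>z. F (drop n z))"
proof -
  have "definable_term (n + k) (\<lambda>z. F (map (\<lambda>j. z ! (n + j)) [0..<k]))"
    by (rule definable_term_subst[OF assms]) (simp add: definable_term_nth)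
  moreover have "map (\<lambda>j. z ! (n + j)) [0..<k] = drop n z" if "length z = n + k" for z :: "real list"
    using that by (intro nth_equalityI) auto
  ultimately show ?thesis
    by (subst definable_term_cong[of _ _ "\<lambda>z. F (map (\<lambda>j. z ! (n + j)) [0..<k])"]) auto
qed

lemma definable_term_app:
  assumes "definable_term 1 (\<lambda>x. u (x ! 0))" "definable_term n F"
  shows "definable_term n (\<lambda>x. u (F x))"
  using definable_term_subst[OF assms(1), of n "\<lambda>_. F"] assms(2) by simp

lemma definable_term_app2:
  assumes "definable_term 2 (\<lambda>x. u (x ! 0) (x ! 1))" "definable_term n F" "definable_term n G"
  shows "definable_term n (\<lambda>x. u (F x) (G x))"
  using definable_term_subst[OF assms(1), of n "\<lambda>j. if j = 0 then F else G"] assms(2,3) by simp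

lemma definable_pred_app:
  assumes "definable_pred 1 (\<lambda>x. P (x ! 0))" "definable_term n F"
  shows "definable_pred n (\<lambda>x. P (F x))"
  using definable_pred_subst[OF assms(1), of n "\<lambda>_. F"] assms(2) by simp

lemma definable_pred_app2:
  assumes "definable_pred 2 (\<lambda>x. P (x ! 0) (x ! 1))" "definable_term n F" "definable_term n G"
  shows "definable_pred n (\<lambda>x. P (F x) (G x))"
  using definable_pred_subst[OF assms(1), of n "\<lambda>j. if j = 0 then F else G"] assms(2,3) by simp

lemma definable_term_add:
  "definable_term n F \<Longrightarrow> definable_term n G \<Longrightarrow> definable_term n (\<lambda>x. F x + G x)"
  by (rule definable_term_app2[of "(+)"], rule definable_term_poly)
     (auto intro!: real_poly.intros)

lemma definable_term_mult:
  "definable_term n F \<Longrightarrow> definable_term n G \<Longrightarrow> definable_term n (\<lambda>x. F x * G x)"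
  by (rule definable_term_app2[of "(*)"], rule definable_term_poly)
     (auto intro!: real_poly.intros)

lemma definable_term_uminus: "definable_term n F \<Longrightarrow> definable_term n (\<lambda>x. - F x)"
  using definable_term_mult[OF definable_term_const[of n "- 1"]] by fastforce

lemma definable_term_diff:
  "definable_term n F \<Longrightarrow> definable_term n G \<Longrightarrow> definable_term n (\<lambda>x. F x - G x)"
  using definable_term_add[OF _ definable_term_uminus] by fastforce

lemma definable_term_power: "definable_term n F \<Longrightarrow> definable_term n (\<lambda>x. F x ^ k)"
  by (induction k) (auto intro: definable_term_const definable_term_mult)

lemma definable_pred_eq:
  assumes "definable_term n F" "definable_term n G"
  shows "definable_pred n (\<lambda>x. F x = G x)"
proof (rule definable_pred_app2[OF _ assms])
  have "definable_pred 2 (\<lambda>x. x ! 0 - x ! 1 = 0)"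
    by (intro definable_pred_poly real_poly_diff real_poly.coord) auto
  then show "definable_pred 2 (\<lambda>x. x ! 0 = x ! 1)" by simp
qed

lemma definable_pred_less:
  assumes "definable_term n F" "definable_term n G"
  shows "definable_pred n (\<lambda>x. F x < G x)"
proof (rule definable_pred_app2[OF _ assms])
  \<comment> \<open>The order is expressed through the field operations: a real is positive iff its
    product with some square is \<open>1\<close>.\<close>
  have "definable_pred 2 (\<lambda>x. \<exists>t. (x ! 1 - x ! 0) * t ^ 2 = 1)"
    by (intro definable_pred_ex definable_pred_eq definable_term_mult definable_term_diff
        definable_term_const definable_term_power)
       (simp_all add: definable_term_nth numeral_2_eq_2)
  moreover have "(\<exists>t. (b - a) * t ^ 2 = 1) \<longleftrightarrow> a < b" for a b :: real
  proof
    assume "\<exists>t. (b - a) * t ^ 2 = 1"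
    then show "a < b"
      by (metis diff_gt_0_iff_gt zero_less_mult_pos2 zero_less_one zero_less_power2 mult_zero_right zero_power2 zero_neq_one)
  next
    assume "a < b"
    then show "\<exists>t. (b - a) * t ^ 2 = 1"
      by (intro exI[of _ "1 / sqrt (b - a)"]) (simp add: power_divide)
  qed
  ultimately show "definable_pred 2 (\<lambda>x. x ! 0 < x ! 1)" by simp
qed

lemma definable_pred_le:
  assumes "definable_term n F" "definable_term n G"
  shows "definable_pred n (\<lambda>x. F x \<le> G x)"
  using definable_pred_not[OF definable_pred_less[OF assms(2,1)]] by (simp add: not_less)

text \<open>For functions given implicitly, by a formula \<open>R\<close> with exactly one solution
  \<open>y\<close> for each \<open>x\<close>.\<close>

lemma definable_termI:
  assumes "definable_pred (Suc n) (\<lambda>x. R (take n x) (x ! n))"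
    and "\<And>x y. length x = n \<Longrightarrow> R x y \<longleftrightarrow> y = F x"
  shows "definable_term n F"
  unfolding definable_term_def
  by (subst definable_pred_cong[of _ _ "\<lambda>x. R (take n x) (x ! n)"]) (simp_all add: assms)

lemma definable_pred_take:
  assumes "definable_pred n P"
  shows "definable_pred (Suc n) (\<lambda>x. P (take n x))"
proof -
  have "definable_pred (Suc n) (\<lambda>x. P (map (\<lambda>j. x ! j) [0..<n]))"
    by (rule definable_pred_reindex[OF assms]) simp
  moreover have "map (\<lambda>j. x ! j) [0..<n] = take n x" if "length x = Suc n" for x :: "real list"
    using that by (intro nth_equalityI) auto
  ultimately show ?thesis
    by (subst definable_pred_cong[of _ _ "\<lambda>x. P (map (\<lambda>j. x ! j) [0..<n])"]) auto
qed

lemma definable_term_if: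
  assumes "definable_pred n P" "definable_term n F" "definable_term n G"
  shows "definable_term n (\<lambda>x. if P x then F x else G x)"
proof (rule definable_termI[where R = "\<lambda>x y. P x \<and> y = F x \<or> \<not> P x \<and> y = G x"])
  show "definable_pred (Suc n) (\<lambda>x. P (take n x) \<and> x ! n = F (take n x) \<or>
      \<not> P (take n x) \<and> x ! n = G (take n x))"
    using assms(2,3) definable_pred_take[OF assms(1)]
    by (intro definable_pred_disj definable_pred_conj definable_pred_not) (auto simp: definable_term_def)
qed auto

lemma definable_term_abs:
  "definable_term n F \<Longrightarrow> definable_term n (\<lambda>x. \<bar>F x\<bar>)"
  unfolding abs_if
  by (intro definable_term_if definable_pred_less definable_term_const definable_term_uminus)

lemma definable_term_divide:
  assumes "definable_term n F" "definable_term n G"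
  shows "definable_term n (\<lambda>x. F x / G x)"
proof (rule definable_term_app2[OF _ assms])
  show "definable_term 2 (\<lambda>x. x ! 0 / x ! 1)"
    \<comment> \<open>The first disjunct accounts for the convention that division by zero gives
      zero.\<close>
    by (rule definable_termI[where R = "\<lambda>x y. x ! 1 = 0 \<and> y = 0 \<or> \<not> x ! 1 = 0 \<and> y * x ! 1 = x ! 0"],
        intro definable_pred_disj definable_pred_conj definable_pred_not definable_pred_eq
          definable_term_mult definable_term_const)
       (auto simp: definable_term_nth field_simps split: if_splits)
qed

lemmas definable_intros =
  definable_pred_conj definable_pred_disj definable_pred_not definable_pred_imp
  definable_pred_ex definable_pred_all definable_pred_eq definable_pred_less definable_pred_le
  definable_term_const definable_term_add definable_term_mult definable_term_uminus
  definable_term_diff definable_term_power definable_term_abs definable_term_divide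

end

section \<open>Definable functions of one variable near the origin\<close>

text \<open>If points of \<open>I\<close> accumulate at \<open>x\<close> from the right, convexity
  of \<open>I\<close> fills the gaps between them.\<close>

lemma interval_eventually_at_right:
  fixes I :: "real set"
  assumes "is_interval I"
  shows "eventually (\<lambda>t. t \<in> I) (at_right x) \<or> eventually (\<lambda>t. t \<notin> I) (at_right x)"
proof (cases "\<exists>y>x. {x<..<y} \<inter> I = {}")
  case True
  then obtain y where "x < y" "{x<..<y} \<inter> I = {}" by blast
  then have "eventually (\<lambda>t. t \<notin> I) (at_right x)"
    by (intro eventually_at_rightI[of x y]) auto
  then show ?thesis ..
next
  case False
  then have "{x<..<x + 1} \<inter> I \<noteq> {}" using less_add_one[of x] by blast
  then obtain b where "b \<in> {x<..<x + 1}" "b \<in> I" by blast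
  then have b: "x < b" "b \<in> I" by simp_all
  have "t \<in> I" if "x < t" "t < b" for t
  proof -
    from False \<open>x < t\<close> have "{x<..<t} \<inter> I \<noteq> {}" by blast
    then obtain z where "z \<in> {x<..<t}" "z \<in> I" by blast
    then have "x < z" "z < t" "z \<in> I" by simp_all
    then show ?thesis using assms b that by (meson is_interval_1 less_imp_le)
  qed
  then have "eventually (\<lambda>t. t \<in> I) (at_right x)"
    using b by (intro eventually_at_rightI[of x b]) auto
  then show ?thesis ..
qed

lemma Union_eventually_at_right:
  fixes F :: "real set set"
  assumes "finite F" "\<And>I. I \<in> F \<Longrightarrow> is_interval I"
  shows "eventually (\<lambda>t. t \<in> \<Union>F) (at_right x) \<or> eventually (\<lambda>t. t \<notin> \<Union>F) (at_right x)"
  using assms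
proof (induction F rule: finite_induct)
  case (insert I F)
  have "eventually (\<lambda>t. t \<in> I) (at_right x) \<or> eventually (\<lambda>t. t \<notin> I) (at_right x)"
    by (rule interval_eventually_at_right) (simp add: insert.prems)
  moreover have "eventually (\<lambda>t. t \<in> \<Union>F) (at_right x) \<or> eventually (\<lambda>t. t \<notin> \<Union>F) (at_right x)"
    by (rule insert.IH) (simp add: insert.prems)
  ultimately consider
      "eventually (\<lambda>t. t \<in> I) (at_right x)" | "eventually (\<lambda>t. t \<in> \<Union>F) (at_right x)"
    | "eventually (\<lambda>t. t \<notin> I \<and> t \<notin> \<Union>F) (at_right x)"
    using eventually_conj by blast
  then show ?case
  proof cases
    case 3
    then have "eventually (\<lambda>t. t \<notin> \<Union>(insert I F)) (at_right x)" by simp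
    then show ?thesis ..
  qed (force elim: eventually_mono)+
qed simp

lemma finite_union_imp_intervals:
  assumes "finite_union_of_points_and_intervals T"
  shows "\<exists>F. finite F \<and> (\<forall>I\<in>F. is_interval I) \<and> T = \<Union>F"
proof -
  have "is_interval {a}" for a :: real by (simp add: is_interval_1)
  then show ?thesis using assms unfolding finite_union_of_points_and_intervals_def by metis
qed

text \<open>Continuous induction: the set where \<open>u a \<le> u x\<close> is closed in the
  interval, so it contains its supremum, and the hypothesis there would push the supremum further
  unless it equals \<open>b\<close>.\<close>

lemma le_of_eventually_right_le:
  fixes u :: "real \<Rightarrow> real"
  assumes "a \<le> b" "continuous_on {a..b} u"
    and ev: "\<And>x. a \<le> x \<Longrightarrow> x < b \<Longrightarrow> eventually (\<lambda>t. u x \<le> u t) (at_right x)"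
  shows "u a \<le> u b"
proof (rule ccontr)
  assume not: "\<not> u a \<le> u b"
  let ?Z = "{x \<in> {a..b}. u a \<le> u x}"
  have "closed ?Z" by (intro continuous_on_closed_Collect_le assms continuous_intros)
  moreover have "?Z \<noteq> {}" using assms(1) by auto
  moreover have bdd: "bdd_above ?Z" by auto
  ultimately have s: "Sup ?Z \<in> ?Z" by (intro closed_contains_Sup)
  define s where "s = Sup ?Z"
  have s': "a \<le> s" "s < b" "u a \<le> u s" using s not unfolding s_def[symmetric] by (auto simp: less_le)
  from ev[OF s'(1,2)] have "eventually (\<lambda>t. u s \<le> u t \<and> t < b \<and> s < t) (at_right s)"
    using s'(2) by (intro eventually_conj) (auto simp: eventually_at_right_field)
  then obtain t where t: "u s \<le> u t" "t < b" "s < t"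
    using eventually_happens[of _ "at_right s"] by auto
  then have "t \<in> ?Z" using s' by auto
  then have "t \<le> s" unfolding s_def using bdd by (rule cSup_upper)
  then show False using t by simp
qed

text \<open>A mean value inequality that needs only one-sided information; it follows by subtracting
  the linear function \<open>c * t\<close>.\<close>

lemma increment_ge_of_eventually_right:
  fixes u :: "real \<Rightarrow> real"
  assumes "a \<le> b" "continuous_on {a..b} u"
    and ev: "\<And>x. a \<le> x \<Longrightarrow> x < b \<Longrightarrow> eventually (\<lambda>t. c * (t - x) \<le> u t - u x) (at_right x)"
  shows "c * (b - a) \<le> u b - u a"
proof -
  have "u a - c * a \<le> u b - c * b"
  proof (rule le_of_eventually_right_le[where u = "\<lambda>t. u t - c * t"])
    fix x assume "a \<le> x" "x < b"
    from ev[OF this] show "eventually (\<lambda>t. u x - c * x \<le> u t - c * t) (at_right x)"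
      by (rule eventually_mono) (simp add: algebra_simps)
  qed (use assms in \<open>auto intro!: continuous_intros\<close>)
  then show ?thesis by (simp add: algebra_simps)
qed

text \<open>The discontinuities of a monotone function are countable, while the interval is
  not.\<close>

lemma mono_on_imp_ex_isCont:
  fixes u :: "real \<Rightarrow> real"
  assumes "mono_on {a<..<b} u" "a < b"
  shows "\<exists>x\<in>{a<..<b}. isCont u x"
proof (rule ccontr)
  assume "\<not> ?thesis"
  then have "{x \<in> {a<..<b}. \<not> isCont u x} = {a<..<b}" by auto
  moreover have "countable {x \<in> {a<..<b}. \<not> isCont u x}"
    using mono_on_ctble_discont_open[of "{a<..<b}" u] assms by simp
  ultimately show False using assms(2) uncountable_open_interval[of a b] by simp
qed

section \<open>Consequences of o-minimality for definable subsets of the line\<close>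

context ominimal_structure
begin

abbreviation definable1 :: "(real \<Rightarrow> bool) \<Rightarrow> bool" where
  "definable1 P \<equiv> definable_pred 1 (\<lambda>x. P (x ! 0))"

abbreviation definable_map :: "(real \<Rightarrow> real) \<Rightarrow> bool" where
  "definable_map u \<equiv> definable_term 1 (\<lambda>x. u (x ! 0))"

lemma definable1_finite_union:
  assumes "definable1 P"
  shows "finite_union_of_points_and_intervals {t. P t}"
proof -
  have "(\<lambda>t. [t]) ` {t. P t} = {x \<in> Rn 1. P (x ! 0)}"
    by (auto simp: Rn_def length_Suc_conv)
  then show ?thesis using assms o_minimal unfolding definable_pred_def by metis
qed

text \<open>The main form in which o-minimality enters: finitely many intervals cannot alternate
  infinitely often near \<open>x\<close>, so every definable property is decided on the right
  germ.\<close>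

lemma definable1_dichotomy:
  assumes "definable1 P"
  shows "eventually P (at_right x) \<or> eventually (\<lambda>t. \<not> P t) (at_right x)"
proof -
  obtain F where "finite F" "\<forall>I\<in>F. is_interval I" "{t. P t} = \<Union>F"
    using finite_union_imp_intervals[OF definable1_finite_union[OF assms]] by blast
  then have "P = (\<lambda>t. t \<in> \<Union>F)" by (metis mem_Collect_eq)
  then show ?thesis using Union_eventually_at_right[of F x] \<open>finite F\<close> \<open>\<forall>I\<in>F. is_interval I\<close>
    by metis
qed

text \<open>One of the finitely many pieces is uncountable, hence has two points and, being an
  interval, everything between them.\<close>

lemma definable1_uncountable:
  assumes "definable1 P" "uncountable {t. P t}"
  obtains a b where "a < b" "\<And>t. a \<le> t \<Longrightarrow> t \<le> b \<Longrightarrow> P t"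
proof -
  obtain F where F: "finite F" "\<forall>I\<in>F. is_interval I" "{t. P t} = \<Union>F"
    using finite_union_imp_intervals[OF definable1_finite_union[OF assms(1)]] by blast
  obtain I where I: "I \<in> F" "uncountable I"
    using assms(2) F(1,3) by (metis countable_UN countable_finite image_ident)
  then have "\<not> (\<exists>a. I \<subseteq> {a})" using countable_subset by fastforce
  then obtain a b where "a \<in> I" "b \<in> I" "a < b"
    by (metis insert_subset linorder_neqE subsetI singleton_iff empty_subsetI)
  then show ?thesis using that[of a b] bspec[OF F(2) I(1)] F(3) I(1)
    by (metis UnionI is_interval_1 mem_Collect_eq)
qed

end

section \<open>Monotonicity and continuity near the origin\<close>

definition locally_increasing :: "(real \<Rightarrow> real) \<Rightarrow> real \<Rightarrow> bool" where
  "locally_increasing u x \<longleftrightarrow>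
     eventually (\<lambda>t. u t \<le> u x) (at_left x) \<and> eventually (\<lambda>t. u x \<le> u t) (at_right x)"

text \<open>The inequalities are weak, as in \<open>locally_increasing\<close>, so a point near
  which \<open>u\<close> is constant has both types. This overlap is what later excludes intervals
  consisting only of minima that are not points of increase.\<close>

definition local_minimum :: "(real \<Rightarrow> real) \<Rightarrow> real \<Rightarrow> bool" where
  "local_minimum u x \<longleftrightarrow>
     eventually (\<lambda>t. u x \<le> u t) (at_left x) \<and> eventually (\<lambda>t. u x \<le> u t) (at_right x)"

text \<open>Compactness of \<open>{r..s}\<close> in the form of \<open>Bolzano\<close> glues the
  local comparisons. Near \<open>x\<close> the two ends of a short interval containing
  \<open>x\<close> are compared through the value at \<open>x\<close>, since the hypothesis relates
  other values only to that one.\<close>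

lemma locally_increasing_imp_mono_on:
  assumes "\<And>x. a < x \<Longrightarrow> x < b \<Longrightarrow> locally_increasing u x"
  shows "mono_on {a<..<b} u"
proof (rule mono_onI)
  fix r s assume rs: "r \<in> {a<..<b}" "s \<in> {a<..<b}" "r \<le> s"
  from rs(3) show "u r \<le> u s"
  proof (induction rule: Bolzano)
    case (local x)
    then have "locally_increasing u x" using rs by (intro assms) auto
    then obtain l h where "l < x" "x < h" "\<And>t. l < t \<Longrightarrow> t < x \<Longrightarrow> u t \<le> u x"
        "\<And>t. x < t \<Longrightarrow> t < h \<Longrightarrow> u x \<le> u t"
      unfolding locally_increasing_def eventually_at_left_field eventually_at_right_field by blast
    then have "u c \<le> u x \<and> u x \<le> u d" if "c \<le> x" "x \<le> d" "d - c < min (x - l) (h - x)" for c d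
      using that by (cases "c = x"; cases "d = x") (auto simp: not_le)
    then show ?case using \<open>l < x\<close> \<open>x < h\<close>
      by (intro exI[of _ "min (x - l) (h - x)"]) (auto intro: order_trans)
  qed auto
qed

context ominimal_structure
begin

lemma definable_map_neg: "definable_map u \<Longrightarrow> definable_map (\<lambda>t. - u t)"
  by (rule definable_term_uminus)

lemma definable1_dichotomy_left:
  assumes "definable1 P"
  shows "eventually P (at_left x) \<or> eventually (\<lambda>t. \<not> P t) (at_left x)"
proof -
  have "definable1 (\<lambda>t. P (- t))"
    by (rule definable_pred_app[OF assms], intro definable_intros definable_term_nth) simp
  from definable1_dichotomy[OF this, of "- x"] show ?thesis
    by (subst (1 2) at_left_minus) (simp add: eventually_filtermap)
qed

text \<open>By the dichotomy, \<open>u t - u x\<close> has a constant weak sign on each side of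
  \<open>x\<close>, which leaves four combinations.\<close>

lemma definable_local_type:
  assumes "definable_map u"
  shows "locally_increasing u x \<or> locally_increasing (\<lambda>t. - u t) x \<or>
         local_minimum u x \<or> local_minimum (\<lambda>t. - u t) x"
proof -
  have def_u: "definable1 (\<lambda>t. u x \<le> u t)"
    by (intro definable_intros assms)
  have imp: "eventually (\<lambda>t. u t \<le> u x) F" if "eventually (\<lambda>t. \<not> u x \<le> u t) F" for F
    using that by (rule eventually_mono) simp
  from definable1_dichotomy[OF def_u, of x] definable1_dichotomy_left[OF def_u, of x]
  have "eventually (\<lambda>t. u x \<le> u t) (at_right x) \<or> eventually (\<lambda>t. u t \<le> u x) (at_right x)"
    "eventually (\<lambda>t. u x \<le> u t) (at_left x) \<or> eventually (\<lambda>t. u t \<le> u x) (at_left x)"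
    using imp by blast+
  then show ?thesis by (auto simp: locally_increasing_def local_minimum_def)
qed

lemma definable1_locally_increasing:
  assumes "definable_map u"
  shows "definable1 (locally_increasing u)"
  unfolding locally_increasing_def eventually_at_left_field eventually_at_right_field
  by (intro definable_intros definable_term_app[OF assms]) (simp_all add: definable_term_nth)

lemma definable1_local_minimum:
  assumes "definable_map u"
  shows "definable1 (local_minimum u)"
  unfolding local_minimum_def eventually_at_left_field eventually_at_right_field
  by (intro definable_intros definable_term_app[OF assms]) (simp_all add: definable_term_nth)

text \<open>The sets \<open>Q n\<close> of minima with uniform radius \<open>1 / Suc n\<close> cover
  the interval, so one is uncountable and contains an interval. On a short piece of it
  \<open>u\<close> is constant.\<close>

lemma local_minimum_everywhere_imp_locally_increasing:
  assumes u: "definable_map u" and "a < b"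
    and min: "\<And>x. a < x \<Longrightarrow> x < b \<Longrightarrow> local_minimum u x"
  shows "\<exists>x. a < x \<and> x < b \<and> locally_increasing u x"
proof -
  define Q where "Q n x \<longleftrightarrow> a < x \<and> x < b \<and>
    (\<forall>t. x - 1 / real (Suc n) < t \<and> t < x + 1 / real (Suc n) \<longrightarrow> u x \<le> u t)" for n x
  have "{a<..<b} \<subseteq> (\<Union>n. {x. Q n x})"
  proof
    fix x assume x: "x \<in> {a<..<b}"
    then have "local_minimum u x" by (intro min) auto
    then obtain l h where lh: "l < x" "x < h" "\<And>t. l < t \<Longrightarrow> t < x \<Longrightarrow> u x \<le> u t"
        "\<And>t. x < t \<Longrightarrow> t < h \<Longrightarrow> u x \<le> u t"
      unfolding local_minimum_def eventually_at_left_field eventually_at_right_field by blast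
    obtain n where n: "1 / real (Suc n) < min (x - l) (h - x)"
      using reals_Archimedean[of "min (x - l) (h - x)"] lh(1,2) by (auto simp: inverse_eq_divide)
    have "u x \<le> u t" if "x - 1 / real (Suc n) < t" "t < x + 1 / real (Suc n)" for t
      using lh(3)[of t] lh(4)[of t] n that by (cases t x rule: linorder_cases) auto
    then show "x \<in> (\<Union>n. {x. Q n x})" using x by (auto simp: Q_def)
  qed
  moreover have "uncountable {a<..<b}" using uncountable_open_interval \<open>a < b\<close> by blast
  ultimately obtain n where n: "uncountable {x. Q n x}"
    by (meson countable_UN countable_subset countableI_type)
  have "definable1 (Q n)"
    unfolding Q_def
    by (intro definable_intros definable_term_app[OF u]) (simp_all add: definable_term_nth)
  from definable1_uncountable[OF this n]
  obtain c d where cd: "c < d" "\<And>t. c \<le> t \<Longrightarrow> t \<le> d \<Longrightarrow> Q n t" by metis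
  \<comment> \<open>After this shortening any two points lie within each other's radius of
    minimality, so their values agree.\<close>
  define e where "e = min d (c + 1 / real (Suc n))"
  have e: "c < e" "e \<le> d" "e - c \<le> 1 / real (Suc n)" using cd(1) by (auto simp: e_def min_def)
  define x where "x = (c + e) / 2"
  have x: "c < x" "x < e" using e by (auto simp: x_def)
  have eq: "u t \<le> u x \<and> u x \<le> u t" if t: "c < t" "t < e" for t
  proof -
    have "Q n t" "Q n x" using cd(2) e x t by auto
    moreover have "x - 1 / real (Suc n) < t" "t < x + 1 / real (Suc n)"
      "t - 1 / real (Suc n) < x" "x < t + 1 / real (Suc n)"
      using e x t by linarith+
    ultimately show ?thesis unfolding Q_def by blast
  qed
  have "eventually (\<lambda>t. u t \<le> u x) (at_left x)" "eventually (\<lambda>t. u x \<le> u t) (at_right x)"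
    using x by (intro eventually_at_leftI[of c] eventually_at_rightI[of x e]; simp add: eq)+
  then have "locally_increasing u x" unfolding locally_increasing_def ..
  moreover have "Q n x" using cd(2) x e by simp
  ultimately show ?thesis unfolding Q_def by blast
qed

text \<open>Otherwise neither \<open>u\<close> nor \<open>- u\<close> is locally increasing at
  points close to \<open>0\<close>, and then the dichotomy makes all such points local minima of
  \<open>u\<close>, or all of \<open>- u\<close>. Both are excluded by the preceding lemma.\<close>

lemma definable_map_monotone:
  assumes u: "definable_map u"
  shows "\<exists>e>0. mono_on {0<..<e} u \<or> mono_on {0<..<e} (\<lambda>t. - u t)"
proof -
  let ?I = "locally_increasing u" and ?D = "locally_increasing (\<lambda>t. - u t)"
  note u' = definable_map_neg[OF u]
  have no_min: False
    if v: "definable_map v" "eventually (\<lambda>x. local_minimum v x \<and> \<not> locally_increasing v x) (at_right 0)" for v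
    using that(2) local_minimum_everywhere_imp_locally_increasing[OF v(1)]
    unfolding eventually_at_right_field by blast
  have "eventually ?I (at_right 0) \<or> eventually ?D (at_right 0)"
  proof (rule ccontr)
    assume "\<not> ?thesis"
    then have not: "eventually (\<lambda>x. \<not> ?I x) (at_right 0)" "eventually (\<lambda>x. \<not> ?D x) (at_right 0)"
      using definable1_dichotomy[OF definable1_locally_increasing[OF u]]
        definable1_dichotomy[OF definable1_locally_increasing[OF u']] by blast+
    consider "eventually (local_minimum u) (at_right 0)"
      | "eventually (\<lambda>x. \<not> local_minimum u x) (at_right 0)"
      using definable1_dichotomy[OF definable1_local_minimum[OF u]] by blast
    then show False
    proof cases
      case 1
      then show ?thesis using no_min[OF u] not(1) eventually_conj by blast
    next
      case 2
      with not have "eventually (\<lambda>x. local_minimum (\<lambda>t. - u t) x \<and> \<not> ?D x) (at_right 0)"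
        by eventually_elim (use definable_local_type[OF u] in blast)
      then show ?thesis by (rule no_min[OF u'])
    qed
  qed
  then show ?thesis
    unfolding eventually_at_right_field using locally_increasing_imp_mono_on by metis
qed

text \<open>The epsilon-delta condition is itself a formula over the definable function
  \<open>u\<close>.\<close>

lemma definable1_isCont:
  assumes "definable_map u"
  shows "definable1 (isCont u)"
  unfolding continuous_at_real_range real_norm_def
  by (intro definable_intros definable_term_app[OF assms]) (simp_all add: definable_term_nth)

lemma definable_map_continuous:
  assumes u: "definable_map u"
  shows "eventually (isCont u) (at_right 0)"
proof (rule ccontr)
  assume "\<not> ?thesis"
  then have "eventually (\<lambda>x. \<not> isCont u x) (at_right 0)"
    using definable1_dichotomy[OF definable1_isCont[OF u]] by blast
  then obtain b where b: "b > 0" "\<And>x. 0 < x \<Longrightarrow> x < b \<Longrightarrow> \<not> isCont u x"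
    unfolding eventually_at_right_field by blast
  obtain e where e: "e > 0" "mono_on {0<..<e} u \<or> mono_on {0<..<e} (\<lambda>t. - u t)"
    using definable_map_monotone[OF u] by blast
  define a where "a = min b e"
  have a: "a > 0" using b(1) e(1) by (simp add: a_def)
  have "{0<..<a} \<subseteq> {0<..<e}" by (auto simp: a_def)
  then have "mono_on {0<..<a} u \<or> mono_on {0<..<a} (\<lambda>t. - u t)"
    using e(2) mono_on_subset by blast
  then obtain x where "x \<in> {0<..<a}" "isCont u x \<or> isCont (\<lambda>t. - u t) x"
    using mono_on_imp_ex_isCont[OF _ a] by blast
  then show False using b(2)[of x] continuous_minus[of "at x" "\<lambda>t. - u t"] by (auto simp: a_def)
qed

end

section \<open>Right derivatives and their relation to two-sided derivatives\<close>

definition has_right_slope :: "(real \<Rightarrow> real) \<Rightarrow> real \<Rightarrow> real \<Rightarrow> bool" where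
  "has_right_slope u x v \<longleftrightarrow>
     (\<forall>e>0. eventually (\<lambda>t. \<bar>u t - u x - v * (t - x)\<bar> \<le> e * (t - x)) (at_right x))"

lemma has_right_slope_unique:
  assumes "has_right_slope u x v" "has_right_slope u x w"
  shows "v = w"
proof (rule ccontr)
  assume "v \<noteq> w"
  define e where "e = \<bar>v - w\<bar> / 3"
  have e: "e > 0" using \<open>v \<noteq> w\<close> by (simp add: e_def)
  have "eventually (\<lambda>t. \<bar>u t - u x - v * (t - x)\<bar> \<le> e * (t - x) \<and>
      \<bar>u t - u x - w * (t - x)\<bar> \<le> e * (t - x) \<and> x < t) (at_right x)"
    using assms e unfolding has_right_slope_def
    by (intro eventually_conj) (auto intro: eventually_at_right_less)
  then obtain t where t: "\<bar>u t - u x - v * (t - x)\<bar> \<le> e * (t - x)"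
      "\<bar>u t - u x - w * (t - x)\<bar> \<le> e * (t - x)" "x < t"
    using eventually_happens[of _ "at_right x"] by auto
  then have "\<bar>(v - w) * (t - x)\<bar> \<le> 2 * e * (t - x)" by (simp add: algebra_simps)
  then have "3 * e * (t - x) \<le> 2 * e * (t - x)" using t(3) by (simp add: abs_mult e_def)
  then show False using t(3) e by simp
qed

lemma has_right_slope_imp_increment_ge:
  fixes u :: "real \<Rightarrow> real"
  assumes "r \<le> s" "\<And>y. r \<le> y \<Longrightarrow> y \<le> s \<Longrightarrow> isCont u y"
    and "\<And>y. r \<le> y \<Longrightarrow> y \<le> s \<Longrightarrow> has_right_slope u y (w y)"
    and "\<And>y. r \<le> y \<Longrightarrow> y \<le> s \<Longrightarrow> c < w y"
  shows "c * (s - r) \<le> u s - u r"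
proof (rule increment_ge_of_eventually_right)
  fix y assume y: "r \<le> y" "y < s"
  then have "c < w y" by (simp add: assms(4))
  then have "eventually (\<lambda>t. \<bar>u t - u y - w y * (t - y)\<bar> \<le> (w y - c) * (t - y)) (at_right y)"
    using assms(3)[of y] y by (simp add: has_right_slope_def)
  then show "eventually (\<lambda>t. c * (t - y) \<le> u t - u y) (at_right y)"
    by (rule eventually_mono) (auto simp: algebra_simps abs_le_iff)
qed (use assms(1,2) in \<open>auto intro!: continuous_at_imp_continuous_on\<close>)

lemma has_right_slope_uminus: "has_right_slope u x v \<Longrightarrow> has_right_slope (\<lambda>t. - u t) x (- v)"
proof -
  have "\<bar>- u t - - u x - - v * (t - x)\<bar> = \<bar>u t - u x - v * (t - x)\<bar>" for t
    by (subst abs_minus_cancel[symmetric]) (simp add: algebra_simps)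
  then show "has_right_slope u x v \<Longrightarrow> ?thesis" by (simp add: has_right_slope_def)
qed

text \<open>Continuity of \<open>w\<close> confines the right slopes near \<open>x\<close> to within
  \<open>e\<close> of \<open>w x\<close>. The one-sided mean value inequality, applied to
  \<open>u\<close> and to \<open>- u\<close>, turns this into a bound on increments on both sides of
  \<open>x\<close>.\<close>

lemma continuous_right_slope_imp_DERIV:
  fixes u :: "real \<Rightarrow> real"
  assumes "a < x" "x < b" "isCont w x"
    and cont: "\<And>y. a < y \<Longrightarrow> y < b \<Longrightarrow> isCont u y"
    and slope: "\<And>y. a < y \<Longrightarrow> y < b \<Longrightarrow> has_right_slope u y (w y)"
  shows "(u has_real_derivative w x) (at x)"
  unfolding has_field_derivative_def has_derivative_at_alt
proof (intro conjI allI impI bounded_linear_mult_right)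
  fix e :: real assume "e > 0"
  then obtain d where d: "d > 0" "\<And>y. \<bar>y - x\<bar> < d \<Longrightarrow> \<bar>w y - w x\<bar> < e"
    using assms(3) unfolding continuous_at_real_range real_norm_def by blast
  define d' where "d' = Min {d, x - a, b - x}"
  have d': "d' > 0" "d' \<le> d" "d' \<le> x - a" "d' \<le> b - x" using d assms by (auto simp: d'_def)
  have incr: "\<bar>u s - u r - w x * (s - r)\<bar> \<le> e * (s - r)"
    if "r \<le> s" "\<bar>r - x\<bar> < d'" "\<bar>s - x\<bar> < d'" for r s
  proof -
    have y: "a < y \<and> y < b \<and> w x - e < w y \<and> - w x - e < - w y" if "r \<le> y" "y \<le> s" for y
    proof -
      have "\<bar>y - x\<bar> < d'" using that \<open>\<bar>r - x\<bar> < d'\<close> \<open>\<bar>s - x\<bar> < d'\<close> by linarith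
      then show ?thesis using d(2)[of y] d' by linarith
    qed
    have "(w x - e) * (s - r) \<le> u s - u r"
      by (rule has_right_slope_imp_increment_ge[where w = w]) (use y that in \<open>auto intro: cont slope\<close>)
    moreover have "(- w x - e) * (s - r) \<le> - u s - - u r"
      by (rule has_right_slope_imp_increment_ge[where u = "\<lambda>t. - u t" and w = "\<lambda>t. - w t"])
         (use y that in \<open>auto intro: cont slope has_right_slope_uminus intro!: continuous_intros\<close>)
    ultimately show ?thesis by (simp add: abs_le_iff algebra_simps)
  qed
  show "\<exists>d>0. \<forall>y. norm (y - x) < d \<longrightarrow> norm (u y - u x - w x * (y - x)) \<le> e * norm (y - x)"
  proof (intro exI[of _ d'] conjI allI impI d'(1))
    fix y assume y: "norm (y - x) < d'"
    show "norm (u y - u x - w x * (y - x)) \<le> e * norm (y - x)"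
    proof (cases "x \<le> y")
      case True
      then show ?thesis using incr[of x y] y d'(1) by simp
    next
      case False
      have "\<bar>u y - u x - w x * (y - x)\<bar> = \<bar>u x - u y - w x * (x - y)\<bar>"
        by (subst abs_minus_cancel[symmetric]) (simp add: algebra_simps)
      then show ?thesis using incr[of y x] y d'(1) False by simp
    qed
  qed
qed

text \<open>The derivative is quantified rather than written \<open>deriv\<close>, which suits
  induction on the order. For positive order it is a two-sided derivative in the line, so the sets
  of interest are open.\<close>

primrec Ck_on :: "nat \<Rightarrow> real set \<Rightarrow> (real \<Rightarrow> real) \<Rightarrow> bool" where
  "Ck_on 0 U f \<longleftrightarrow> continuous_on U f"
| "Ck_on (Suc p) U f \<longleftrightarrow> (\<exists>f'. (\<forall>x\<in>U. (f has_real_derivative f' x) (at x)) \<and> Ck_on p U f')"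

lemma Ck_on_subset: "Ck_on p U f \<Longrightarrow> V \<subseteq> U \<Longrightarrow> Ck_on p V f"
  by (induction p arbitrary: f) (auto intro: continuous_on_subset)

section \<open>Regularity of definable functions to the right of the origin\<close>

context ominimal_structure
begin

text \<open>With infinite right slopes on a whole interval, the increment between two fixed points
  would exceed every multiple of their distance.\<close>

lemma not_eventually_infinite_right_slope:
  assumes u: "definable_map u"
  shows "\<not> eventually (\<lambda>x. \<forall>c. eventually (\<lambda>t. c * (t - x) \<le> u t - u x) (at_right x)) (at_right 0)"
proof
  assume "eventually (\<lambda>x. \<forall>c. eventually (\<lambda>t. c * (t - x) \<le> u t - u x) (at_right x)) (at_right 0)"
  from eventually_conj[OF this definable_map_continuous[OF u]]
  obtain b where b: "b > 0"
    "\<And>x c. 0 < x \<Longrightarrow> x < b \<Longrightarrow> eventually (\<lambda>t. c * (t - x) \<le> u t - u x) (at_right x)"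
    "\<And>x. 0 < x \<Longrightarrow> x < b \<Longrightarrow> isCont u x"
    unfolding eventually_at_right_field by blast
  define r s where "r = b / 3" and "s = 2 * b / 3"
  have rs: "0 < r" "r < s" "s < b" using b(1) by (auto simp: r_def s_def)
  have "c * (s - r) \<le> u s - u r" for c
    by (rule increment_ge_of_eventually_right)
       (use rs in \<open>auto intro!: b continuous_at_imp_continuous_on\<close>)
  from this[of "(u s - u r) / (s - r) + 1"] show False using rs by (simp add: distrib_right)
qed

text \<open>The slopes \<open>c\<close> of lines through \<open>(x, u x)\<close> lying below the
  graph on the right germ form a lower cut \<open>C\<close>, and by the dichotomy those outside
  \<open>C\<close> give lines above it. The two hypotheses make \<open>C\<close> bounded above and
  nonempty; the right slope is \<open>Sup C\<close>.\<close>

lemma ex_right_slope: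
  assumes u: "definable_map u"
    and fin: "\<exists>c. \<not> eventually (\<lambda>t. c * (t - x) \<le> u t - u x) (at_right x)"
      "\<exists>c. \<not> eventually (\<lambda>t. c * (t - x) \<le> - u t - - u x) (at_right x)"
  shows "\<exists>v. has_right_slope u x v"
proof -
  define C where "C = {c. eventually (\<lambda>t. c * (t - x) \<le> u t - u x) (at_right x)}"
  have gt: "eventually (\<lambda>t. x < t) (at_right x)" by (rule eventually_at_right_less)
  have def1: "definable1 (\<lambda>t. c * (t - x) \<le> u t - u x)" for c
    by (intro definable_intros definable_term_app[OF u]) (simp_all add: definable_term_nth)
  have not_C: "eventually (\<lambda>t. u t - u x \<le> c * (t - x)) (at_right x)" if "c \<notin> C" for c
  proof -
    have "eventually (\<lambda>t. \<not> c * (t - x) \<le> u t - u x) (at_right x)"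
      using definable1_dichotomy[OF def1, of c x] that by (auto simp: C_def)
    then show ?thesis by (rule eventually_mono) simp
  qed
  have down: "c' \<in> C" if "c \<in> C" "c' \<le> c" for c c'
  proof -
    have "eventually (\<lambda>t. c * (t - x) \<le> u t - u x) (at_right x)" using that by (simp add: C_def)
    with gt have "eventually (\<lambda>t. c' * (t - x) \<le> u t - u x) (at_right x)"
    proof eventually_elim
      case (elim t)
      have "c' * (t - x) \<le> c * (t - x)" using elim that by (intro mult_right_mono) auto
      then show ?case using elim(2) by (rule order_trans)
    qed
    then show ?thesis by (simp add: C_def)
  qed
  from fin(1) obtain c0 where "c0 \<notin> C" by (auto simp: C_def)
  then have bdd: "bdd_above C" using down by (intro bdd_aboveI[of _ c0]) (metis linear)
  from fin(2) obtain c1 where c1: "\<not> eventually (\<lambda>t. c1 * (t - x) \<le> - u t - - u x) (at_right x)"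
    by blast
  have "- c1 \<in> C"
  proof (rule ccontr)
    assume "- c1 \<notin> C"
    from not_C[OF this] have "eventually (\<lambda>t. c1 * (t - x) \<le> - u t - - u x) (at_right x)"
      by (rule eventually_mono) simp
    with c1 show False ..
  qed
  then have ne: "C \<noteq> {}" by auto
  have "eventually (\<lambda>t. \<bar>u t - u x - Sup C * (t - x)\<bar> \<le> e * (t - x)) (at_right x)" if "e > 0" for e
  proof -
    obtain c where "c \<in> C" "Sup C - e < c"
      using less_cSupD[OF ne, of "Sup C - e"] \<open>e > 0\<close> by auto
    then have "Sup C - e \<in> C" using down by auto
    then have "eventually (\<lambda>t. (Sup C - e) * (t - x) \<le> u t - u x) (at_right x)" by (simp add: C_def)
    moreover have "Sup C + e \<notin> C" using cSup_upper[OF _ bdd, of "Sup C + e"] that by auto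
    then have "eventually (\<lambda>t. u t - u x \<le> (Sup C + e) * (t - x)) (at_right x)" by (rule not_C)
    ultimately show ?thesis
      by eventually_elim (simp add: abs_le_iff algebra_simps)
  qed
  then show ?thesis unfolding has_right_slope_def by blast
qed

text \<open>The slope condition has its denominators cleared, so it is a formula in \<open>u\<close>
  and the field operations.\<close>

lemma definable_pred_right_slope:
  assumes u: "definable_map u" and "definable_term n F" "definable_term n G"
  shows "definable_pred n (\<lambda>x. has_right_slope u (F x) (G x))"
proof (rule definable_pred_app2[OF _ assms(2,3)])
  show "definable_pred 2 (\<lambda>x. has_right_slope u (x ! 0) (x ! 1))"
    unfolding has_right_slope_def eventually_at_right_field
    by (intro definable_intros definable_term_app[OF u])
       (simp_all add: definable_term_nth)
qed

text \<open>Uniqueness of the slope makes its defining formula a graph; the value \<open>0\<close>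
  off \<open>P\<close> makes the function total.\<close>

lemma definable_map_right_slope:
  assumes u: "definable_map u" and P: "definable1 P"
    and slope: "\<And>x. P x \<Longrightarrow> has_right_slope u x (v x)"
  shows "definable_map (\<lambda>x. if P x then v x else 0)"
proof (rule definable_termI[where R = "\<lambda>x y. P (x ! 0) \<and> has_right_slope u (x ! 0) y \<or> \<not> P (x ! 0) \<and> y = 0"])
  show "definable_pred (Suc 1) (\<lambda>x. P (take 1 x ! 0) \<and> has_right_slope u (take 1 x ! 0) (x ! 1) \<or>
      \<not> P (take 1 x ! 0) \<and> x ! 1 = 0)"
    by (intro definable_intros definable_pred_app[OF P] definable_pred_right_slope[OF u])
       (simp_all add: definable_term_nth)
qed (use slope has_right_slope_unique in auto)

text \<open>Near \<open>0\<close> the right slopes of \<open>u\<close> are finite, hence exist and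
  form a definable function \<open>w\<close>. This \<open>w\<close> is continuous on a smaller
  interval, where it is therefore the two-sided derivative.\<close>

lemma definable_map_differentiable:
  assumes u: "definable_map u"
  shows "\<exists>v e. definable_map v \<and> e > 0 \<and> (\<forall>x. 0 < x \<and> x < e \<longrightarrow> (u has_real_derivative v x) (at x))"
proof -
  let ?inf = "\<lambda>u x. \<forall>c. eventually (\<lambda>t. c * (t - x) \<le> u t - u x) (at_right x)"
  have ev_not: "eventually (\<lambda>x. \<not> ?inf u x) (at_right 0)" if u: "definable_map u" for u
  proof -
    have def_inf: "definable1 (?inf u)"
      unfolding eventually_at_right_field
      by (intro definable_intros definable_term_app[OF u]) (simp_all add: definable_term_nth)
    then show ?thesis
      using definable1_dichotomy[where P = "?inf u" and x = 0, OF def_inf]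
        not_eventually_infinite_right_slope[OF u] by blast
  qed
  from eventually_conj[OF definable_map_continuous[OF u]
      eventually_conj[OF ev_not[OF u] ev_not[OF definable_map_neg[OF u]]]]
  obtain b where b: "b > 0" "\<And>x. 0 < x \<Longrightarrow> x < b \<Longrightarrow> isCont u x \<and> \<not> ?inf u x \<and> \<not> ?inf (\<lambda>t. - u t) x"
    unfolding eventually_at_right_field[of _ 0] by blast
  have "\<exists>v. has_right_slope u x v" if "0 < x" "x < b" for x
    using b(2)[OF that] by (intro ex_right_slope[OF u]) auto
  then obtain v where v: "\<And>x. 0 < x \<Longrightarrow> x < b \<Longrightarrow> has_right_slope u x (v x)" by metis
  define w where "w x = (if 0 < x \<and> x < b then v x else 0)" for x
  have w: "definable_map w"
    unfolding w_def
    by (rule definable_map_right_slope[OF u], intro definable_intros)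
       (simp_all add: definable_term_nth v)
  obtain e where e: "e > 0" "\<And>x. 0 < x \<Longrightarrow> x < e \<Longrightarrow> isCont w x"
    using definable_map_continuous[OF w] unfolding eventually_at_right_field by blast
  have w_v: "has_right_slope u x (w x)" if "0 < x" "x < b" for x
    using v[OF that] that by (simp add: w_def)
  have "(u has_real_derivative w x) (at x)" if "0 < x" "x < min b e" for x
    by (rule continuous_right_slope_imp_DERIV[of 0 x "min b e"])
       (use that b(2) e(2) w_v in auto)
  then show ?thesis using w b(1) e(1) by (intro exI[of _ w] exI[of _ "min b e"]) auto
qed

text \<open>The derivative is again definable, so differentiability can be iterated; the interval
  may shrink with each order.\<close>

lemma definable_map_Ck_near_0:
  assumes "definable_map u"
  shows "\<exists>e>0. Ck_on p {0<..<e} u"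
  using assms
proof (induction p arbitrary: u)
  case 0
  from definable_map_continuous[OF this] obtain e where "e > 0" "\<And>x. 0 < x \<Longrightarrow> x < e \<Longrightarrow> isCont u x"
    unfolding eventually_at_right_field by blast
  then show ?case by (auto intro!: exI[of _ e] continuous_at_imp_continuous_on)
next
  case (Suc p)
  obtain v e where v: "definable_map v" "e > 0" "\<And>x. 0 < x \<Longrightarrow> x < e \<Longrightarrow> (u has_real_derivative v x) (at x)"
    using definable_map_differentiable[OF Suc.prems] by blast
  obtain d where "d > 0" "Ck_on p {0<..<d} v" using Suc.IH[OF v(1)] by blast
  then show ?case using v(2,3)
    by (intro exI[of _ "min d e"]) (auto intro!: exI[of _ v] elim: Ck_on_subset)
qed

end

section \<open>Flatness at the origin\<close>

lemma Ck_on_SucI: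
  "(\<And>x. x \<in> U \<Longrightarrow> (f has_real_derivative f' x) (at x)) \<Longrightarrow> Ck_on p U f' \<Longrightarrow> Ck_on (Suc p) U f"
  by auto

lemma Ck_on_Suc_imp: "Ck_on (Suc p) U f \<Longrightarrow> Ck_on p U f"
proof (induction p arbitrary: f)
  case 0
  then have "\<forall>x\<in>U. isCont f x" using DERIV_isCont by fastforce
  then show ?case by (simp add: continuous_at_imp_continuous_on)
next
  case (Suc p)
  from Suc.prems obtain f' where "\<forall>x\<in>U. (f has_real_derivative f' x) (at x)" "Ck_on (Suc p) U f'"
    unfolding Ck_on.simps(2)[of "Suc p"] by blast
  then show ?case using Suc.IH[of f'] by (intro Ck_on_SucI) auto
qed

lemma Ck_on_const: "Ck_on p U (\<lambda>x. c)"
proof (induction p arbitrary: c)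
  case (Suc p)
  show ?case unfolding Ck_on.simps by (rule exI[of _ "\<lambda>x. 0"]) (simp add: Suc)
qed simp

lemma Ck_on_id: "Ck_on p U (\<lambda>x. x)"
  by (cases p) (auto intro!: exI[of _ "\<lambda>x. 1"] Ck_on_const)

lemma Ck_on_add: "Ck_on p U f \<Longrightarrow> Ck_on p U g \<Longrightarrow> Ck_on p U (\<lambda>x. f x + g x)"
proof (induction p arbitrary: f g)
  case (Suc p)
  then obtain f' g' where "\<forall>x\<in>U. (f has_real_derivative f' x) (at x)" "Ck_on p U f'"
      "\<forall>x\<in>U. (g has_real_derivative g' x) (at x)" "Ck_on p U g'"
    by auto
  then show ?case using Suc.IH[of f' g'] by (intro Ck_on_SucI[where f' = "\<lambda>x. f' x + g' x"] DERIV_add) auto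
qed (auto intro: continuous_on_add)

lemma Ck_on_mult: "Ck_on p U f \<Longrightarrow> Ck_on p U g \<Longrightarrow> Ck_on p U (\<lambda>x. f x * g x)"
proof (induction p arbitrary: f g)
  case (Suc p)
  then obtain f' g' where *: "\<forall>x\<in>U. (f has_real_derivative f' x) (at x)" "Ck_on p U f'"
      "\<forall>x\<in>U. (g has_real_derivative g' x) (at x)" "Ck_on p U g'"
    by auto
  have "Ck_on p U (\<lambda>x. f' x * g x + g' x * f x)"
    by (intro Ck_on_add Suc.IH * Suc.prems[THEN Ck_on_Suc_imp])
  then show ?case
    by (rule Ck_on_SucI[rotated]) (use * in \<open>intro DERIV_mult; simp\<close>)
qed (auto intro: continuous_on_mult)

lemma Ck_on_cong: "(\<And>x. x \<in> U \<Longrightarrow> f x = g x) \<Longrightarrow> open U \<Longrightarrow> Ck_on p U f \<Longrightarrow> Ck_on p U g"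
proof (cases p)
  case (Suc q)
  assume eq: "\<And>x. x \<in> U \<Longrightarrow> f x = g x" and U: "open U" and "Ck_on p U f"
  then obtain f' where f': "\<forall>x\<in>U. (f has_real_derivative f' x) (at x)" "Ck_on q U f'"
    using Suc by auto
  have "(g has_real_derivative f' x) (at x)" if "x \<in> U" for x
    using has_field_derivative_transform_within_open[of f "f' x" x U g] f'(1) U eq that by blast
  then show ?thesis unfolding Suc using f'(2) by (rule Ck_on_SucI)
qed (auto cong: continuous_on_cong)

lemma Ck_on_compose:
  "Ck_on p V f \<Longrightarrow> Ck_on p U g \<Longrightarrow> g ` U \<subseteq> V \<Longrightarrow> Ck_on p U (\<lambda>x. f (g x))"
proof (induction p arbitrary: f)
  case 0
  then show ?case by (auto intro: continuous_on_compose2)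
next
  case (Suc p)
  then obtain f' g' where *: "\<forall>x\<in>V. (f has_real_derivative f' x) (at x)" "Ck_on p V f'"
      "\<forall>x\<in>U. (g has_real_derivative g' x) (at x)" "Ck_on p U g'"
    by auto
  have "Ck_on p U (\<lambda>x. f' (g x) * g' x)"
    using Suc.IH[OF *(2) Ck_on_Suc_imp[OF Suc.prems(2)] Suc.prems(3)] *(4) by (rule Ck_on_mult)
  moreover have "((\<lambda>x. f (g x)) has_real_derivative f' (g x) * g' x) (at x)" if "x \<in> U" for x
    using * Suc.prems(3) that by (intro DERIV_chain2) auto
  ultimately show ?case by (intro Ck_on_SucI)
qed

lemma Ck_on_inverse: "Ck_on p {0<..} inverse"
proof (induction p)
  case (Suc p)
  have "Ck_on p {0<..} (\<lambda>x. - 1 * (inverse x * inverse x))"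
    by (intro Ck_on_mult Ck_on_const Suc)
  moreover have "(inverse has_real_derivative - 1 * (inverse x * inverse x)) (at x)" if "x > 0" for x :: real
    using DERIV_inverse[of x UNIV] that by (simp add: power2_eq_square)
  ultimately show ?case by (intro Ck_on_SucI) auto
qed (auto intro!: continuous_intros)

text \<open>A recursive form of being of class \<open>C^p\<close> with all derivatives up to order
  \<open>p\<close> vanishing at \<open>0\<close>, adapted to induction on \<open>p\<close>.\<close>

primrec flat :: "nat \<Rightarrow> (real \<Rightarrow> real) \<Rightarrow> bool" where
  "flat 0 f \<longleftrightarrow> f 0 = 0 \<and> continuous_on UNIV f"
| "flat (Suc p) f \<longleftrightarrow> f 0 = 0 \<and> (\<exists>f'. (\<forall>x. (f has_real_derivative f' x) (at x)) \<and> flat p f')"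

lemma flat_imp_C_class: "flat p f \<Longrightarrow> C_class p f \<and> (\<forall>k\<le>p. (deriv ^^ k) f 0 = 0)"
proof (induction p arbitrary: f)
  case (Suc p)
  then obtain f' where f': "f 0 = 0" "\<And>x. (f has_real_derivative f' x) (at x)" "flat p f'"
    by auto
  have "deriv f = f'" using f'(2) DERIV_imp_deriv by blast
  then have shift: "(deriv ^^ Suc k) f = (deriv ^^ k) f'" for k
    by (simp add: funpow_swap1)
  note IH = Suc.IH[OF f'(3)]
  have "(deriv ^^ k) f differentiable at x" if "k < Suc p" for k x
  proof (cases k)
    case 0
    then show ?thesis using f'(2) real_differentiable_def by auto
  next
    case (Suc j)
    then show ?thesis using IH that shift[of j] by (auto simp: C_class_def)
  qed
  moreover have "continuous_on UNIV ((deriv ^^ Suc p) f)" using IH shift[of p] by (auto simp: C_class_def)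
  moreover have "(deriv ^^ k) f 0 = 0" if "k \<le> Suc p" for k
  proof (cases k)
    case (Suc j)
    then show ?thesis using IH that shift[of j] by auto
  qed (use f' in simp)
  ultimately show ?case unfolding C_class_def by blast
qed (simp add: C_class_def)

lemma DERIV_imp_has_right_slope:
  assumes "(u has_real_derivative v) (at x)"
  shows "has_right_slope u x v"
  unfolding has_right_slope_def
proof (intro allI impI)
  fix e :: real assume "e > 0"
  then obtain d where d: "d > 0" "\<And>y. \<bar>y - x\<bar> < d \<Longrightarrow> \<bar>u y - u x - v * (y - x)\<bar> \<le> e * \<bar>y - x\<bar>"
    using assms unfolding has_field_derivative_def has_derivative_at_alt real_norm_def by blast
  show "eventually (\<lambda>t. \<bar>u t - u x - v * (t - x)\<bar> \<le> e * (t - x)) (at_right x)"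
  proof (rule eventually_at_rightI[of x "x + d"])
    fix t assume "t \<in> {x<..<x + d}"
    then show "\<bar>u t - u x - v * (t - x)\<bar> \<le> e * (t - x)" using d(2)[of t] by simp
  qed (use d(1) in simp)
qed

text \<open>By the mean value theorem, the increments of \<open>u\<close> over \<open>{t/2..t}\<close> and \<open>{t..2t}\<close> bound a monotone
  derivative from below and from above.\<close>

lemma mono_derivative_bound:
  fixes u v :: "real \<Rightarrow> real"
  assumes "mono_on {0<..<e} v"
    and deriv: "\<And>x. 0 < x \<Longrightarrow> x < e \<Longrightarrow> (u has_real_derivative v x) (at x)"
    and bound: "\<And>x. 0 < x \<Longrightarrow> x < e \<Longrightarrow> \<bar>u x\<bar> \<le> K"
    and t: "0 < t" "t < e / 2"
  shows "\<bar>t * v t\<bar> \<le> 4 * K"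
proof -
  have "\<exists>z. t < z \<and> z < 2 * t \<and> u (2 * t) - u t = (2 * t - t) * v z"
    using t by (intro MVT2) (auto intro!: deriv)
  then obtain z where z: "t < z" "z < 2 * t" "u (2 * t) - u t = t * v z" by auto
  have "\<exists>y. t / 2 < y \<and> y < t \<and> u t - u (t / 2) = (t - t / 2) * v y"
    using t by (intro MVT2) (auto intro!: deriv)
  then obtain y where y: "t / 2 < y" "y < t" "u t - u (t / 2) = (t / 2) * v y" by auto
  have "v t \<le> v z" "v y \<le> v t"
    using t y z by (auto intro!: mono_onD[OF assms(1)])
  then have "t * v t \<le> t * v z" "t * v y \<le> t * v t" using t by auto
  moreover have "\<bar>u (2 * t)\<bar> \<le> K" "\<bar>u t\<bar> \<le> K" "\<bar>u (t / 2)\<bar> \<le> K" using t by (auto intro!: bound)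
  \<comment> \<open>The left increment runs over length \<open>t / 2\<close> only; this doubles the
    bound \<open>2 * K\<close> on increments and gives \<open>4 * K\<close>.\<close>
  ultimately show ?thesis using y(3) z(3) by (simp add: abs_le_iff)
qed

lemma tendsto_power_times_bounded:
  fixes u :: "real \<Rightarrow> real"
  assumes "e > 0" "\<And>x. x \<noteq> 0 \<Longrightarrow> \<bar>x\<bar> < e \<Longrightarrow> \<bar>u x\<bar> \<le> K" "N \<ge> 1"
  shows "((\<lambda>t. t ^ N * u t) \<longlongrightarrow> 0) (at 0)"
proof (rule Lim_null_comparison)
  have "((\<lambda>t. \<bar>t\<bar> ^ N * K) \<longlongrightarrow> \<bar>0\<bar> ^ N * K) (at (0::real))" by (intro tendsto_intros)
  then show "((\<lambda>t::real. \<bar>t\<bar> ^ N * K) \<longlongrightarrow> 0) (at 0)" using \<open>N \<ge> 1\<close> by (simp add: power_0_left)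
  show "eventually (\<lambda>t. norm (t ^ N * u t) \<le> \<bar>t\<bar> ^ N * K) (at 0)"
    unfolding eventually_at
    by (rule exI[of _ e]) (use assms(1,2) in \<open>auto simp: abs_mult power_abs intro!: mult_left_mono\<close>)
qed

context ominimal_structure
begin

text \<open>Close to \<open>0\<close> the definable derivative is monotone up to sign; the
  decreasing case is the increasing one for \<open>- u\<close> and \<open>- v\<close>.\<close>

lemma definable_map_derivative_bound:
  assumes v: "definable_map v" and "e > 0"
    and deriv: "\<And>x. 0 < x \<Longrightarrow> x < e \<Longrightarrow> (u has_real_derivative v x) (at x)"
    and bound: "\<And>x. 0 < x \<Longrightarrow> x < e \<Longrightarrow> \<bar>u x\<bar> \<le> K"
  shows "\<exists>d>0. \<forall>t. 0 < t \<and> t < d \<longrightarrow> \<bar>t * v t\<bar> \<le> 4 * K"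
proof -
  obtain d where d: "d > 0" "mono_on {0<..<d} v \<or> mono_on {0<..<d} (\<lambda>t. - v t)"
    using definable_map_monotone[OF v] by blast
  define a where "a = min d e"
  have a: "a > 0" "a \<le> d" "a \<le> e" using d(1) \<open>e > 0\<close> by (auto simp: a_def)
  have "{0<..<a} \<subseteq> {0<..<d}" using a by auto
  then have mono: "mono_on {0<..<a} v \<or> mono_on {0<..<a} (\<lambda>t. - v t)"
    using d(2) mono_on_subset by blast
  have "\<bar>t * v t\<bar> \<le> 4 * K" if t: "0 < t" "t < a / 2" for t
    using mono
  proof
    assume "mono_on {0<..<a} v"
    then show ?thesis by (rule mono_derivative_bound[OF _ deriv bound t]) (use a in auto)
  next
    assume "mono_on {0<..<a} (\<lambda>t. - v t)"
    then have "\<bar>t * - v t\<bar> \<le> 4 * K"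
      by (rule mono_derivative_bound[where u = "\<lambda>t. - u t", OF _ _ _ t])
         (use a in \<open>auto intro!: deriv bound DERIV_minus\<close>)
    then show ?thesis by simp
  qed
  then show ?thesis using a(1) by (intro exI[of _ "a / 2"]) auto
qed

text \<open>The derivative \<open>v\<close> is arbitrary at \<open>0\<close>, so it is reset there
  before definability can be claimed.\<close>

lemma definable_map_derivative:
  assumes "definable_map u" "\<And>x. x \<noteq> 0 \<Longrightarrow> (u has_real_derivative v x) (at x)"
  shows "definable_map (\<lambda>x. if x \<noteq> 0 then v x else 0)"
  by (rule definable_map_right_slope[OF assms(1)], intro definable_intros)
     (simp_all add: definable_term_nth DERIV_imp_has_right_slope assms(2))

text \<open>The derivative of \<open>t\<^sup>N u(t)\<close> is \<open>t\<^sup>N\<^sup>-\<^sup>1 (N u(t) + t u'(t))\<close>, and the second factor is again definable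
  and bounded near \<open>0\<close>.\<close>

lemma flat_power_times:
  assumes "definable_map u" "Ck_on p (- {0}) u" "e > 0"
    and "\<And>x. x \<noteq> 0 \<Longrightarrow> \<bar>x\<bar> < e \<Longrightarrow> \<bar>u x\<bar> \<le> K" "N \<ge> Suc p"
  shows "flat p (\<lambda>t. t ^ N * u t)"
  using assms
proof (induction p arbitrary: u e K N)
  case 0
  have "isCont (\<lambda>t. t ^ N * u t) x" for x
  proof (cases "x = 0")
    case True
    then show ?thesis
      using tendsto_power_times_bounded[OF 0(3,4), where N = N] 0(5) by (simp add: isCont_def power_0_left)
  next
    case False
    then have "isCont u x" using 0(2) continuous_on_eq_continuous_at[of "- {0}" u] by (simp add: open_Compl)
    then show ?thesis by (intro continuous_intros)
  qed
  then show ?case using 0(5) by (auto intro!: continuous_at_imp_continuous_on simp: power_0_left)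
next
  case (Suc p)
  from Suc.prems(2) obtain u' where u': "\<And>x. x \<noteq> 0 \<Longrightarrow> (u has_real_derivative u' x) (at x)"
      "Ck_on p (- {0}) u'"
    by auto
  define v where "v x = (if x \<noteq> 0 then u' x else 0)" for x
  have v: "definable_map v"
    unfolding v_def by (rule definable_map_derivative[OF Suc.prems(1) u'(1)])
  have v_deriv: "(u has_real_derivative v x) (at x)" if "x \<noteq> 0" for x
    using u'(1)[OF that] that by (simp add: v_def)
  obtain M where M: "N = Suc M" "M \<ge> Suc p" using Suc.prems(5) by (cases N) auto
  define w where "w t = real N * u t + t * v t" for t
  have w: "definable_map w"
    unfolding w_def
    by (intro definable_intros definable_term_app[OF v] definable_term_app[OF Suc.prems(1)])
       (simp_all add: definable_term_nth)
  have "Ck_on p (- {0}) v"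
    by (rule Ck_on_cong[OF _ _ u'(2)]) (auto simp: v_def)
  then have Ck_w: "Ck_on p (- {0}) w"
    unfolding w_def by (intro Ck_on_add Ck_on_mult Ck_on_const Ck_on_id Ck_on_Suc_imp[OF Suc.prems(2)])
  obtain d1 where d1: "d1 > 0" "\<And>t. 0 < t \<Longrightarrow> t < d1 \<Longrightarrow> \<bar>t * v t\<bar> \<le> 4 * K"
    using definable_map_derivative_bound[OF v Suc.prems(3), of u K] v_deriv Suc.prems(4) by force
  \<comment> \<open>To the left of \<open>0\<close> the bound is obtained from the reflected
    function \<open>u (- t)\<close>, whose derivative is \<open>- v (- t)\<close>.\<close>
  have refl: "definable_map (\<lambda>t. - v (- t))"
    by (intro definable_intros definable_term_app[OF v]) (simp_all add: definable_term_nth)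
  have "((\<lambda>t. u (- t)) has_real_derivative - v (- x)) (at x)" if "0 < x" for x
    using DERIV_chain2[OF v_deriv[of "- x"] DERIV_minus[OF DERIV_ident]] that by simp
  then obtain d2 where d2: "d2 > 0" "\<And>t. 0 < t \<Longrightarrow> t < d2 \<Longrightarrow> \<bar>t * - v (- t)\<bar> \<le> 4 * K"
    using definable_map_derivative_bound[OF refl Suc.prems(3), of "\<lambda>t. u (- t)" K] Suc.prems(4) by force
  define d where "d = Min {d1, d2, e}"
  have d: "d > 0" "d \<le> d1" "d \<le> d2" "d \<le> e" using d1(1) d2(1) Suc.prems(3) by (auto simp: d_def)
  have w_bound: "\<bar>w x\<bar> \<le> real N * K + 4 * K" if "x \<noteq> 0" "\<bar>x\<bar> < d" for x
  proof -
    have "\<bar>x * v x\<bar> \<le> 4 * K"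
      using d1(2)[of x] d2(2)[of "- x"] that d by (cases "x > 0") auto
    moreover have "\<bar>real N * u x\<bar> \<le> real N * K"
      using Suc.prems(4)[of x] that d by (auto simp: abs_mult intro!: mult_left_mono)
    ultimately show ?thesis unfolding w_def by linarith
  qed
  have flat_w: "flat p (\<lambda>t. t ^ M * w t)"
    by (rule Suc.IH[OF w Ck_w d(1) w_bound M(2)])
  have "((\<lambda>t. t ^ N * u t) has_real_derivative x ^ M * w x) (at x)" for x
  proof (cases "x = 0")
    case True
    \<comment> \<open>At the origin the difference quotient of \<open>t ^ N * u t\<close> is
      \<open>h ^ M * u h\<close>, and \<open>M \<ge> 1\<close> makes it tend to
      \<open>0\<close>.\<close>
    have "((\<lambda>h. h ^ M * u h) \<longlongrightarrow> 0) (at 0)"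
      using tendsto_power_times_bounded[OF Suc.prems(3,4), where N = M] M(2) by simp
    then have "((\<lambda>h. ((0 + h) ^ N * u (0 + h) - 0 ^ N * u 0) / h) \<longlongrightarrow> 0) (at 0)"
      by (rule Lim_transform_eventually) (auto simp: eventually_at_filter M(1))
    then show ?thesis using True M(2) by (simp add: DERIV_def power_0_left)
  next
    case False
    have "((\<lambda>t. t ^ N * u t) has_real_derivative real N * x ^ M * u x + v x * x ^ N) (at x)"
      using DERIV_mult[OF DERIV_pow[of N x UNIV] v_deriv[OF False]] M(1) by simp
    then show ?thesis by (simp add: w_def M(1) algebra_simps)
  qed
  moreover have "0 ^ N * u 0 = 0" using M(1) by simp
  ultimately show ?case
    unfolding flat.simps using flat_w by (intro conjI exI[of _ "\<lambda>x. x ^ M * w x"] allI)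
qed

end

section \<open>The flat minorant\<close>

lemma odd_increasing_bijection:
  fixes \<phi> :: "real \<Rightarrow> real"
  assumes odd: "\<And>x. \<phi> (- x) = - \<phi> x"
    and incr: "\<And>s t. 0 \<le> s \<Longrightarrow> s < t \<Longrightarrow> \<phi> s < \<phi> t"
    and cont: "continuous_on UNIV \<phi>"
    and unbounded: "\<And>y. \<exists>x\<ge>0. y \<le> \<phi> x"
  shows "strict_mono \<phi>" "bij \<phi>"
proof -
  have zero: "\<phi> 0 = 0" using odd[of 0] by simp
  show mono: "strict_mono \<phi>"
  proof (rule strict_monoI)
    fix s t :: real assume "s < t"
    then consider "0 \<le> s" | "s < 0" "0 \<le> t" | "t < 0" by linarith
    then show "\<phi> s < \<phi> t"
    proof cases
      case 1
      then show ?thesis using incr \<open>s < t\<close> by simp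
    next
      case 2
      have "\<phi> 0 < \<phi> (- s)" using 2 by (intro incr) auto
      moreover have "\<phi> 0 \<le> \<phi> t" using 2 incr[of 0 t] by (cases "t = 0") auto
      ultimately show ?thesis using odd[of s] zero by simp
    next
      case 3
      have "\<phi> (- t) < \<phi> (- s)" using 3 \<open>s < t\<close> by (intro incr) auto
      then show ?thesis using odd by simp
    qed
  qed
  have pos: "\<exists>x. \<phi> x = y" if y: "0 \<le> y" for y
  proof -
    obtain b where "b \<ge> 0" "y \<le> \<phi> b" using unbounded by blast
    then show ?thesis
      using IVT'[of \<phi> 0 y b] y zero continuous_on_subset[OF cont, of "{0..b}"] by auto
  qed
  have "\<exists>x. y = \<phi> x" for y
  proof (cases "0 \<le> y")
    case False
    then obtain x where "\<phi> x = - y" using pos[of "- y"] by auto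
    then show ?thesis using odd[of x] by (intro exI[of _ "- x"]) simp
  qed (use pos in metis)
  then show "bij \<phi>"
    using strict_mono_imp_inj_on[OF mono] by (simp add: bij_def surj_def)
qed

lemma flat_imp_continuous: "flat p f \<Longrightarrow> continuous_on UNIV f"
proof (cases p)
  case (Suc q)
  assume "flat p f"
  then have "\<forall>x. isCont f x" using DERIV_isCont Suc by fastforce
  then show ?thesis by (simp add: continuous_at_imp_continuous_on)
qed simp

context ominimal_structure
begin

lemma ex_Phi_le:
  assumes h: "definable_map h" and mono: "mono h" and pos: "\<And>t. t > 0 \<Longrightarrow> h t > 0"
    and bound: "\<And>t. 0 \<le> h t \<and> h t \<le> 1" and "M \<ge> 0"
  shows "\<exists>\<phi>\<in>Phi p. definable_map \<phi> \<and> (\<forall>t. \<bar>t\<bar> \<le> M \<longrightarrow> \<bar>\<phi> t\<bar> \<le> h \<bar>t\<bar>)"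
proof -
  obtain e0 where e0: "e0 > 0" "Ck_on p {0<..<e0} h" using definable_map_Ck_near_0[OF h] by blast
  define e where "e = min e0 1"
  have e: "e > 0" "e \<le> 1" "e \<le> e0" using e0(1) by (auto simp: e_def)
  have "{0<..<e} \<subseteq> {0<..<e0}" using e by auto
  then have Ck_h: "Ck_on p {0<..<e} h" by (rule Ck_on_subset[OF e0(2)])
  \<comment> \<open>\<open>\<sigma>\<close> is even, nondecreasing on the right half-line and at
    most \<open>|t|\<close>; it maps the punctured line into \<open>(0, e)\<close>, where
    \<open>h\<close> is of class \<open>C^p\<close>.\<close>
  define \<sigma> where "\<sigma> t = e * (t * t / (1 + t * t))" for t
  \<comment> \<open>The exponent is odd, so that \<open>\<phi>\<close> is odd although
    \<open>u\<close> is even, and at least \<open>Suc p\<close>, as flatness of order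
    \<open>p\<close> requires.\<close>
  define N where "N = Suc (2 * p)"
  \<comment> \<open>This gives \<open>|t| ^ N * c \<le> 1\<close> for \<open>|t| \<le> M\<close>;
    the summand \<open>1\<close> keeps the denominator positive at \<open>M = 0\<close>.\<close>
  define c where "c = 1 / (1 + M) ^ N"
  have c: "c > 0" using \<open>M \<ge> 0\<close> by (simp add: c_def)
  define u where "u t = c * h (\<sigma> t)" for t
  define \<phi> where "\<phi> t = t ^ N * u t" for t
  have one: "1 + t * t > 0" for t :: real by (simp add: add_pos_nonneg)
  have \<sigma>_pos: "\<sigma> t > 0" if "t \<noteq> 0" for t
  proof -
    have "t * t > 0" using that not_real_square_gt_zero by blast
    then show ?thesis unfolding \<sigma>_def using e(1) one[of t] by (intro mult_pos_pos[OF e(1)] divide_pos_pos)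
  qed
  have \<sigma>_less: "\<sigma> t < e" for t
    using mult_strict_left_mono[OF _ e(1), of "t * t / (1 + t * t)" 1] one[of t] by (simp add: \<sigma>_def)
  have \<sigma>_le: "\<sigma> t \<le> \<bar>t\<bar>" for t
  proof -
    have "t * t \<le> \<bar>t\<bar> * (1 + t * t)"
    proof (cases "\<bar>t\<bar> \<le> 1")
      case True
      then have "\<bar>t\<bar> * \<bar>t\<bar> \<le> \<bar>t\<bar> * 1" by (intro mult_left_mono) auto
      then show ?thesis by (simp add: distrib_left add_increasing2)
    next
      case False
      then have "1 * (t * t) \<le> \<bar>t\<bar> * (t * t)" by (intro mult_right_mono) auto
      then show ?thesis by (simp add: distrib_left)
    qed
    then have "t * t / (1 + t * t) \<le> \<bar>t\<bar>" using one[of t] by (simp add: divide_le_eq)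
    moreover have "0 \<le> t * t / (1 + t * t)" using one[of t] by simp
    ultimately show ?thesis unfolding \<sigma>_def using e by (smt (verit) mult_left_le_one_le)
  qed
  have \<sigma>_mono: "\<sigma> s \<le> \<sigma> t" if "0 \<le> s" "s \<le> t" for s t
  proof -
    have "s * s \<le> t * t" using that by (intro mult_mono) auto
    then have "s * s / (1 + s * s) \<le> t * t / (1 + t * t)"
      using one[of s] one[of t] by (simp add: divide_simps algebra_simps)
    then show ?thesis unfolding \<sigma>_def using e(1) by (intro mult_left_mono) auto
  qed
  have u_nonneg: "0 \<le> u t" and u_le: "u t \<le> c" for t
    using bound[of "\<sigma> t"] c by (simp_all add: u_def mult_left_le)
  have u_pos: "0 < u t" if "t \<noteq> 0" for t using pos[OF \<sigma>_pos[OF that]] c by (simp add: u_def)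
  have u_mono: "u s \<le> u t" if "0 \<le> s" "s \<le> t" for s t
    using monoD[OF mono \<sigma>_mono[OF that]] c by (simp add: u_def)
  have def_u: "definable_map u"
    unfolding u_def \<sigma>_def
    by (intro definable_intros definable_term_app[OF h]) (simp_all add: definable_term_nth)
  have Ck_\<sigma>: "Ck_on p (- {0}) \<sigma>"
  proof -
    have "Ck_on p (- {0}) (\<lambda>t. inverse (1 + t * t))"
      by (rule Ck_on_compose[OF Ck_on_inverse])
         (use one in \<open>auto intro!: Ck_on_add Ck_on_mult Ck_on_const Ck_on_id\<close>)
    then show ?thesis
      unfolding \<sigma>_def divide_inverse by (intro Ck_on_mult Ck_on_const Ck_on_id)
  qed
  have "\<sigma> ` (- {0}) \<subseteq> {0<..<e}"
    by (rule image_subsetI) (simp add: \<sigma>_pos \<sigma>_less)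
  then have Ck_u: "Ck_on p (- {0}) u"
    unfolding u_def by (intro Ck_on_mult Ck_on_const Ck_on_compose[OF Ck_h Ck_\<sigma>])
  have flat: "flat p \<phi>"
    unfolding \<phi>_def
    by (rule flat_power_times[OF def_u Ck_u zero_less_one, of c])
       (use u_nonneg u_le in \<open>auto simp: N_def\<close>)
  have odd: "\<phi> (- t) = - \<phi> t" for t
    by (simp add: \<phi>_def u_def \<sigma>_def N_def)
  have incr: "\<phi> s < \<phi> t" if "0 \<le> s" "s < t" for s t
  proof -
    \<comment> \<open>Strict growth comes from the power alone, as \<open>u\<close> is merely
      nondecreasing.\<close>
    have "s ^ N * u s \<le> s ^ N * u t" using that by (intro mult_left_mono u_mono) auto
    also have "\<dots> < t ^ N * u t"
      using that u_pos[of t] by (intro mult_strict_right_mono power_strict_mono) (auto simp: N_def)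
    finally show ?thesis by (simp add: \<phi>_def)
  qed
  have unbounded: "\<exists>x\<ge>0. y \<le> \<phi> x" for y
  proof -
    \<comment> \<open>For \<open>x \<ge> 1\<close> both \<open>x \<le> x ^ N\<close> and
      \<open>u 1 \<le> u x\<close> hold, so it suffices that \<open>x * u 1\<close> reaches
      \<open>y\<close>.\<close>
    define x where "x = max 1 (y / u 1)"
    have "y \<le> x * u 1" using u_pos[of 1] by (simp add: x_def pos_divide_le_eq[symmetric])
    also have "\<dots> \<le> x ^ N * u x"
    proof (rule mult_mono)
      show "x \<le> x ^ N" using self_le_power[of x N] by (simp add: x_def N_def)
    qed (auto simp: x_def u_nonneg intro!: u_mono)
    finally show ?thesis by (intro exI[of _ x]) (auto simp: \<phi>_def x_def)
  qed
  have "\<bar>\<phi> t\<bar> \<le> h \<bar>t\<bar>" if "\<bar>t\<bar> \<le> M" for t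
  proof -
    have "\<bar>t\<bar> ^ N \<le> (1 + M) ^ N" using that by (intro power_mono) auto
    then have "\<bar>t\<bar> ^ N * c \<le> 1" using \<open>M \<ge> 0\<close> by (simp add: c_def divide_le_eq)
    then have "\<bar>t\<bar> ^ N * c * h (\<sigma> t) \<le> h (\<sigma> t)"
      using bound[of "\<sigma> t"] by (intro mult_left_le_one_le) (auto simp: c less_imp_le)
    moreover have "\<bar>\<phi> t\<bar> = \<bar>t\<bar> ^ N * c * h (\<sigma> t)"
      using u_nonneg[of t] by (simp add: \<phi>_def abs_mult power_abs) (simp add: u_def)
    ultimately show ?thesis using monoD[OF mono \<sigma>_le[of t]] by linarith
  qed
  moreover have "definable_map \<phi>"
    unfolding \<phi>_def
    by (intro definable_intros definable_term_app[OF def_u]) (simp_all add: definable_term_nth)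
  moreover have "\<phi> \<in> Phi p"
    using odd odd_increasing_bijection[OF odd incr flat_imp_continuous[OF flat] unbounded]
      flat_imp_C_class[OF flat]
    by (auto simp: Phi_def)
  ultimately show ?thesis by blast
qed

section \<open>From functions on \<open>A\<close> to a definable modulus on the line\<close>

lemma definable_fun_imp_graph:
  assumes "definable_fun S m A f"
  shows "definable_pred (Suc m) (\<lambda>z. take m z \<in> A \<and> z ! m = f (take m z))"
proof -
  have A: "A \<subseteq> Rn m" and graph: "{x @ [f x] | x. x \<in> A} \<in> S (Suc m)"
    using assms by (auto simp: definable_fun_def)
  have "{z \<in> Rn (Suc m). take m z \<in> A \<and> z ! m = f (take m z)} = {x @ [f x] | x. x \<in> A}"
  proof (intro equalityI subsetI)
    fix z assume z: "z \<in> {z \<in> Rn (Suc m). take m z \<in> A \<and> z ! m = f (take m z)}"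
    then have "z = take m z @ [f (take m z)]"
      by (metis (mono_tags, lifting) Rn_def mem_Collect_eq lessI take_Suc_conv_app_nth order_refl take_all_iff)
    with z show "z \<in> {x @ [f x] | x. x \<in> A}" by blast
  qed (use A in \<open>auto simp: Rn_def nth_append\<close>)
  then show ?thesis using graph by (simp add: definable_pred_def)
qed

text \<open>The domain is the projection of the graph.\<close>

lemma definable_fun_imp_domain:
  assumes "definable_fun S m A f"
  shows "definable_pred m (\<lambda>x. x \<in> A)"
proof -
  have "definable_pred m (\<lambda>x. \<exists>t. x \<in> A \<and> t = f x)"
    by (rule definable_pred_ex) (rule definable_fun_imp_graph[OF assms])
  then show ?thesis by simp
qed

lemma definable_fun_imp_definable_term:
  assumes "definable_fun S m A f"
  shows "definable_term m (\<lambda>x. if x \<in> A then f x else 0)"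
proof (rule definable_termI[where R = "\<lambda>x y. x \<in> A \<and> y = f x \<or> \<not> x \<in> A \<and> y = 0"])
  show "definable_pred (Suc m) (\<lambda>x. take m x \<in> A \<and> x ! m = f (take m x) \<or> \<not> take m x \<in> A \<and> x ! m = 0)"
    by (intro definable_pred_disj definable_fun_imp_graph[OF assms])
       (intro definable_intros definable_term_nth definable_pred_take
          definable_fun_imp_domain[OF assms] lessI)
qed auto

lemma ex_definable_modulus:
  assumes f: "definable_fun S m A f" and g: "definable_fun S m A g"
    and lim: "\<And>x :: nat \<Rightarrow> real list. (\<And>n. x n \<in> A) \<Longrightarrow>
           (\<lambda>n. f (x n)) \<longlonglongrightarrow> 0 \<Longrightarrow> (\<lambda>n. g (x n)) \<longlonglongrightarrow> 0"
  shows "\<exists>h. definable_map h \<and> mono h \<and> (\<forall>t>0. h t > 0) \<and> (\<forall>t. 0 \<le> h t \<and> h t \<le> 1) \<and>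
    (\<forall>x\<in>A. h \<bar>g x\<bar> \<le> \<bar>f x\<bar>)"
proof -
  define F where "F x = (if x \<in> A then f x else 0)" for x
  define G where "G x = (if x \<in> A then g x else 0)" for x
  have F: "definable_term m F" and G: "definable_term m G"
    unfolding F_def G_def by (intro definable_fun_imp_definable_term f g)+
  \<comment> \<open>\<open>E t\<close> holds of the values of \<open>|f|\<close> on the part of
    \<open>A\<close> where \<open>|g|\<close> is at least \<open>t\<close>. The clause
    \<open>length x = m\<close> puts the quantifier into the form handled by
    \<open>definable_pred_ex_list\<close>.\<close>
  define E where "E t r \<longleftrightarrow> (\<exists>x. length x = m \<and> x \<in> A \<and> t \<le> \<bar>G x\<bar> \<and> r = \<bar>F x\<bar>)" for t r
  have "definable_pred 2 (\<lambda>z. E (z ! 0) (z ! 1))"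
    unfolding E_def
    by (intro definable_pred_ex_list definable_pred_prod[OF definable_fun_imp_domain[OF f]]
        definable_intros definable_term_drop[OF F] definable_term_drop[OF G])
       (simp_all add: definable_term_nth)
  note E_intro = definable_pred_app2[OF this]
  have A: "length x = m" if "x \<in> A" for x using f that by (auto simp: definable_fun_def Rn_def)
  \<comment> \<open>The element \<open>1\<close> keeps the infimum meaningful when
    \<open>|g|\<close> never reaches \<open>t\<close>, and also gives
    \<open>h \<le> 1\<close>.\<close>
  define X where "X t = insert 1 {r. E t r}" for t
  define h where "h t = Inf (X t)" for t
  have X: "X t \<noteq> {}" "bdd_below (X t)" for t
    unfolding X_def by (auto simp: E_def intro!: bdd_belowI[of _ 0])
  have def_h: "definable_map h"
  \<comment> \<open>The infimum is described as the greatest lower bound, which is a formula in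
    \<open>E\<close> and the order.\<close>
  proof (rule definable_termI[where R = "\<lambda>x y. (y \<le> 1 \<and> (\<forall>r. E (x ! 0) r \<longrightarrow> y \<le> r)) \<and>
      (\<forall>y'. y' \<le> 1 \<and> (\<forall>r. E (x ! 0) r \<longrightarrow> y' \<le> r) \<longrightarrow> y' \<le> y)"])
    fix x :: "real list" and y
    show "(y \<le> 1 \<and> (\<forall>r. E (x ! 0) r \<longrightarrow> y \<le> r)) \<and>
      (\<forall>y'. y' \<le> 1 \<and> (\<forall>r. E (x ! 0) r \<longrightarrow> y' \<le> r) \<longrightarrow> y' \<le> y) \<longleftrightarrow> y = h (x ! 0)" (is "?L = ?R")
    proof
      assume ?L
      then show ?R unfolding h_def using X(1) by (intro cInf_eq_non_empty[symmetric]) (auto simp: X_def)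
    next
      assume ?R
      have "y \<le> r" if "r \<in> X (x ! 0)" for r
        unfolding \<open>?R\<close> h_def using that X(2) by (rule cInf_lower)
      moreover have "y' \<le> y" if "\<And>r. r \<in> X (x ! 0) \<Longrightarrow> y' \<le> r" for y'
        unfolding \<open>?R\<close> h_def using X(1) that by (rule cInf_greatest)
      ultimately show ?L by (auto simp: X_def)
    qed
  qed (intro definable_intros E_intro; simp add: definable_term_nth)
  have "mono h"
    unfolding h_def using X
    by (intro monoI cInf_superset_mono) (auto simp: X_def E_def)
  moreover have h_pos: "h t > 0" if "t > 0" for t
  proof (rule ccontr)
    assume "\<not> h t > 0"
    \<comment> \<open>A vanishing infimum yields points with \<open>f\<close> tending to
      \<open>0\<close> while \<open>|g|\<close> stays at least \<open>t\<close>, against the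
      hypothesis on sequences.\<close>
    have "\<exists>x. x \<in> A \<and> t \<le> \<bar>g x\<bar> \<and> \<bar>f x\<bar> < 1 / real (Suc n)" for n
    proof -
      have "h t < 1 / real (Suc n)" using \<open>\<not> h t > 0\<close> by (smt (verit) of_nat_0_less_iff zero_less_Suc divide_pos_pos)
      then obtain r where "r \<in> X t" "r < 1 / real (Suc n)"
        unfolding h_def using cInf_lessD[OF X(1)] by blast
      then show ?thesis by (force simp: X_def E_def F_def G_def divide_simps)
    qed
    then obtain x where x: "\<And>n. x n \<in> A" "\<And>n. t \<le> \<bar>g (x n)\<bar>" "\<And>n. \<bar>f (x n)\<bar> < 1 / real (Suc n)"
      by metis
    have "(\<lambda>n. f (x n)) \<longlonglongrightarrow> 0"
    proof (rule Lim_null_comparison)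
      show "(\<lambda>n. 1 / real (Suc n)) \<longlonglongrightarrow> 0"
        using LIMSEQ_inverse_real_of_nat by (simp add: inverse_eq_divide)
      show "eventually (\<lambda>n. norm (f (x n)) \<le> 1 / real (Suc n)) sequentially"
        using x(3) by (simp add: less_imp_le)
    qed
    from lim[OF x(1) this] have "(\<lambda>n. \<bar>g (x n)\<bar>) \<longlonglongrightarrow> 0" by (rule tendsto_rabs_zero)
    then have "t \<le> 0" using x(2) by (intro LIMSEQ_le_const) auto
    then show False using that by simp
  qed
  moreover have "0 \<le> h t \<and> h t \<le> 1" for t
    unfolding h_def using X
    by (auto intro!: cInf_greatest cInf_lower) (auto simp: X_def E_def)
  moreover have "h \<bar>g x\<bar> \<le> \<bar>f x\<bar>" if "x \<in> A" for x
    unfolding h_def using X(2) that A by (intro cInf_lower) (auto simp: X_def E_def F_def G_def)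
  ultimately show ?thesis using def_h by blast
qed

lemma definable_map_imp_definable_real_fun:
  assumes "definable_map \<phi>"
  shows "definable_real_fun S \<phi>"
proof -
  have "{x @ [\<phi> (x ! 0)] | x. x \<in> Rn 1} = {z \<in> Rn (Suc 1). z ! 1 = \<phi> (take 1 z ! 0)}"
    by (auto simp: Rn_def length_Suc_conv)
  then show ?thesis
    using assms by (simp add: definable_real_fun_def definable_fun_def definable_term_def definable_pred_def)
qed

end

theorem theorem3p6:
  fixes S :: "nat \<Rightarrow> real list set set"
    and p m :: nat
    and A :: "real list set"
    and f g :: "real list \<Rightarrow> real"
  assumes "ominimal_structure S"
    and "p \<ge> 1"
    and "A \<subseteq> Rn m"
    and "definable_fun S m A f"
    and "definable_fun S m A g"
    and "bounded ((\<lambda>x. \<bar>g x\<bar>) ` A)"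
    and "\<And>x :: nat \<Rightarrow> real list. (\<And>n. x n \<in> A) \<Longrightarrow>
           (\<lambda>n. f (x n)) \<longlonglongrightarrow> 0 \<Longrightarrow> (\<lambda>n. g (x n)) \<longlonglongrightarrow> 0"
  shows "\<exists>\<phi> \<in> Phi p. definable_real_fun S \<phi> \<and> (\<forall>x\<in>A. \<bar>f x\<bar> \<ge> \<bar>\<phi> (g x)\<bar>)"
proof -
  interpret ominimal_structure S by fact
  obtain h where h: "definable_map h" "mono h" "\<And>t. t > 0 \<Longrightarrow> h t > 0" "\<And>t. 0 \<le> h t \<and> h t \<le> 1"
      "\<And>x. x \<in> A \<Longrightarrow> h \<bar>g x\<bar> \<le> \<bar>f x\<bar>"
    using ex_definable_modulus[OF assms(4,5,7)] by blast
  obtain M where M: "M > 0" "\<And>x. x \<in> A \<Longrightarrow> \<bar>g x\<bar> \<le> M"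
    using assms(6) unfolding bounded_pos by auto
  obtain \<phi> where \<phi>: "\<phi> \<in> Phi p" "definable_map \<phi>" "\<And>t. \<bar>t\<bar> \<le> M \<Longrightarrow> \<bar>\<phi> t\<bar> \<le> h \<bar>t\<bar>"
    using ex_Phi_le[OF h(1-4), of M p] M(1) by auto
  \<comment> \<open>The chain is \<open>|\<phi> (g x)| \<le> h |g x| \<le> |f x|\<close>, where the
    first inequality uses \<open>|g x| \<le> M\<close>.\<close>
  then show ?thesis
    using M(2) h(5) definable_map_imp_definable_real_fun by (meson order_trans)
qed

end
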